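(* Assume the setting below, fix $\lambda>0$, and suppose $\varpi_{H-qB}+q\,\varpi_B>0$. Then for every $\bm x\in\mathbb{R}^d$ the stochastic integral $$X_\lambda(\bm x)=\int_{\mathbb{R}^d}\Big[e^{-\lambda\varphi(\bm x-\bm y)}\varphi(\bm x-\bm y)^{H-qB}-e^{-\lambda\varphi(-\bm y)}\varphi(-\bm y)^{H-qB}\Big]M(d\bm y)$$ exists.
   Context: Notation: for a square complex matrix $A$, $\varpi_A$ and $\Upsilon_A$ denote the minimum and maximum of the real parts of the eigenvalues of $A$; $A^*$ is the conjugate transpose; for $c>0$, $c^A:=\exp((\log c)A)=\sum_{k\ge0}((\log c)A)^k/k!$. Let $E\in\mathcal M(d,\mathbb{R})$ have all eigenvalues with positive real part and put $q:=\mathrm{tr}(E)>0$. A function $\varphi:\mathbb{R}^d\to[0,\infty)$ is called $E$-homogeneous if $\varphi(c^E\bm x)=c\,\varphi(\bm x)$ for all $\bm x\neq 0$, $c>0$; here $\varphi$ is continuous, $E$-homogeneous, and $\varphi(\bm x)>0$ for $\bm x\ne0$. Let $H\in\mathcal M(n,\mathbb{R})$ with $\varpi_H>0$. Let $\mu$ be a full (support not contained in any affine hyperplane) strictly operator-stable probability measure on $\mathbb{R}^n$ with exponent $B\in\mathcal M(n,\mathbb{R})$, i.e. $\mu$ is infinitely divisible and its characteristic function satisfies $\hat\mu(\mathbf u)^s=\hat\mu(s^B\mathbf u)$ for all $s>0$, $\mathbf u\in\mathbb{R}^n$; let $\hat\psi$ be its log-characteristic function (the unique continuous function with $\hat\psi(0)=0$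 and $\hat\mu=e^{\hat\psi}$). Let $M(d\bm y)$ be the $\mathbb{R}^n$-valued independently scattered random measure on $\mathbb{R}^d$ generated by $\mu$ and Lebesgue measure: for Borel $A$ of finite Lebesgue measure, $M(A)$ is infinitely divisible with Lévy triplet equal to $\mathrm{Leb}(A)$ times the triplet of $\mu$, values on disjoint sets are independent, and $M$ is a.s. $\sigma$-additive. For measurable $f:\mathbb{R}^d\to\mathcal M(n,\mathbb{R})$, the stochastic integral $\int f\,dM$ (in the sense of Kremer–Scheffler, i.e. as the limit of integrals of simple functions) exists iff this construction converges, and then $\mathbb{E}\exp\{i\mathbf u^t\int f\,dM\}=\exp\{\int_{\mathbb{R}^d}\hat\psi(f(\bm x)^*\mathbf u)\,d\bm x\}$. *)

theory Defs
  imports "HOL-Probability.Probability"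
begin

definition cmat :: "real^'n^'n \<Rightarrow> complex^'n^'n" where
  "cmat A = (\<chi> i j. complex_of_real (A$i$j))"

definition eigenvalues :: "real^'n^'n \<Rightarrow> complex set" where
  "eigenvalues A = {l. \<exists>v::complex^'n. v \<noteq> 0 \<and> cmat A *v v = l *s v}"

definition min_re_eig :: "real^'n^'n \<Rightarrow> real" where
  "min_re_eig A = Min (Re ` eigenvalues A)"

definition max_re_eig :: "real^'n^'n \<Rightarrow> real" where
  "max_re_eig A = Max (Re ` eigenvalues A)"

definition mtrace :: "real^'n^'n \<Rightarrow> real" where
  "mtrace A = (\<Sum>i\<in>UNIV. A$i$i)"

definition mpow :: "real^'n^'n \<Rightarrow> nat \<Rightarrow> real^'n^'n" where
  "mpow A k = ((\<lambda>C. C ** A) ^^ k) (mat 1)"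

definition matrix_cpow :: "real \<Rightarrow> real^'n^'n \<Rightarrow> real^'n^'n" where
  "matrix_cpow c A = (\<Sum>k. ((ln c) ^ k / fact k) *\<^sub>R mpow A k)"

definition E_homogeneous :: "real^'d^'d \<Rightarrow> (real^'d \<Rightarrow> real) \<Rightarrow> bool" where
  "E_homogeneous E \<phi> \<longleftrightarrow>
     (\<forall>x c. x \<noteq> 0 \<longrightarrow> c > 0 \<longrightarrow> \<phi> (matrix_cpow c E *v x) = c * \<phi> x)"

definition charfun_v :: "(real^'n) measure \<Rightarrow> real^'n \<Rightarrow> complex" where
  "charfun_v M u = (\<integral>x. exp (\<i> * complex_of_real (u \<bullet> x)) \<partial>M)"

definition inf_div :: "(real^'n) measure \<Rightarrow> bool" where
  "inf_div \<mu> \<longleftrightarrow> (\<forall>k::nat. k \<ge> 1 \<longrightarrow>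
     (\<exists>\<nu>. prob_space \<nu> \<and> sets \<nu> = sets borel \<and>
          (\<forall>u. charfun_v \<nu> u ^ k = charfun_v \<mu> u)))"

definition msupport :: "(real^'n) measure \<Rightarrow> (real^'n) set" where
  "msupport \<mu> = {x. \<forall>e>0. emeasure \<mu> (ball x e) > 0}"

definition full_measure :: "(real^'n) measure \<Rightarrow> bool" where
  "full_measure \<mu> \<longleftrightarrow> \<not> (\<exists>a b. a \<noteq> 0 \<and> msupport \<mu> \<subseteq> {x. a \<bullet> x = b})"

definition log_charfun :: "(real^'n) measure \<Rightarrow> (real^'n \<Rightarrow> complex) \<Rightarrow> bool" where
  "log_charfun \<mu> \<psi> \<longleftrightarrow> continuous_on UNIV \<psi> \<and> \<psi> 0 = 0 \<and>
     (\<forall>u. charfun_v \<mu> u = exp (\<psi> u))"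

definition adm :: "(real^'d) set \<Rightarrow> bool" where
  "adm A \<longleftrightarrow> A \<in> sets lborel \<and> emeasure lborel A < \<infinity>"

text \<open>Mr A is the random vector M(A); its law has characteristic function
  exp(Leb(A) psi), i.e. Levy triplet Leb(A) times that of mu.\<close>
definition indep_scattered_rm ::
  "'w measure \<Rightarrow> ((real^'d) set \<Rightarrow> 'w \<Rightarrow> real^'n) \<Rightarrow> (real^'n \<Rightarrow> complex) \<Rightarrow> bool" where
  "indep_scattered_rm P Mr \<psi> \<longleftrightarrow> prob_space P \<and>
     (\<forall>A. adm A \<longrightarrow> Mr A \<in> borel_measurable P \<and>
        (\<forall>u. charfun_v (distr P borel (Mr A)) u =
              exp (complex_of_real (measure lborel A) * \<psi> u))) \<and>
     (\<forall>F. (\<forall>A\<in>F. adm A) \<longrightarrow> disjoint F \<longrightarrow>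
        prob_space.indep_vars P (\<lambda>_. borel) Mr F) \<and>
     (\<forall>A::nat \<Rightarrow> (real^'d) set. (\<forall>k. adm (A k)) \<longrightarrow> disjoint_family A \<longrightarrow>
        adm (\<Union>k. A k) \<longrightarrow>
        (AE \<omega> in P. (\<lambda>k. Mr (A k) \<omega>) sums Mr (\<Union>k. A k) \<omega>))"

definition simple_valid :: "((real^'d) set \<times> (real^'n^'n)) list \<Rightarrow> bool" where
  "simple_valid S \<longleftrightarrow> (\<forall>p\<in>set S. adm (fst p)) \<and>
     disjoint_family_on (\<lambda>i. fst (S!i)) {..<length S}"

definition simple_fun :: "((real^'d) set \<times> (real^'n^'n)) list \<Rightarrow> real^'d \<Rightarrow> real^'n^'n" where
  "simple_fun S x = (\<Sum>p\<leftarrow>S. indicator (fst p) x *\<^sub>R snd p)"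

definition simple_int ::
  "((real^'d) set \<Rightarrow> 'w \<Rightarrow> real^'n) \<Rightarrow> ((real^'d) set \<times> (real^'n^'n)) list
     \<Rightarrow> (real^'d) set \<Rightarrow> 'w \<Rightarrow> real^'n" where
  "simple_int Mr S A \<omega> = (\<Sum>p\<leftarrow>S. snd p *v Mr (A \<inter> fst p) \<omega>)"

definition conv_in_prob :: "'w measure \<Rightarrow> (nat \<Rightarrow> 'w \<Rightarrow> real^'n) \<Rightarrow> ('w \<Rightarrow> real^'n) \<Rightarrow> bool" where
  "conv_in_prob P X Y \<longleftrightarrow> Y \<in> borel_measurable P \<and>
     (\<forall>e>0. (\<lambda>n. measure P {\<omega>\<in>space P. dist (X n \<omega>) (Y \<omega>) > e}) \<longlonglongrightarrow> 0)"

text \<open>Existence of the stochastic integral of f w.r.t. M (Kremer--Scheffler,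
  following Rajput--Rosinski): simple f_n -> f a.e., and for every Borel A the
  integrals over A of f_n converge in probability.\<close>
definition KS_integrable ::
  "'w measure \<Rightarrow> ((real^'d) set \<Rightarrow> 'w \<Rightarrow> real^'n) \<Rightarrow> (real^'d \<Rightarrow> real^'n^'n) \<Rightarrow> bool" where
  "KS_integrable P Mr f \<longleftrightarrow> f \<in> borel_measurable lborel \<and>
     (\<exists>S. (\<forall>n. simple_valid (S n)) \<and>
          (AE x in lborel. (\<lambda>n. simple_fun (S n) x) \<longlonglongrightarrow> f x) \<and>
          (\<forall>A\<in>sets lborel. \<exists>Y. conv_in_prob P (\<lambda>n. simple_int Mr (S n) A) Y))"

end

theory Submission
  imports Defs "HOL-Computational_Algebra.Fundamental_Theorem_Algebra"
begin

text \<open>Fix \<open>\<beta> < \<varpi>\<^sub>B\<close> and \<open>\<gamma>\<close> slightly below \<open>\<varpi>\<close> of \<open>D = H - q B\<close>, so that \<open>\<gamma> + q \<beta> > 0\<close> and \<open>\<beta> > 0\<close>;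
  the latter is possible because a full law forces \<open>\<varpi>\<^sub>B > 0\<close>. Polar coordinates \<open>u = s^B \<theta>\<close> turn
  \<open>\<psi> (s^B \<theta>) = s \<psi> \<theta>\<close> into \<open>\<bar>\<psi> u\<bar> \<le> K (\<bar>u\<bar>^a + \<bar>u\<bar>^b)\<close> with \<open>a = 1/\<beta> \<ge> b > 0\<close>. Hence it is enough that the kernel
  is in \<open>L^a\<close> and \<open>L^b\<close>: dominated approximation by simple functions then makes the characteristic functions of
  the differences of the simple integrals tend to 1, uniformly over the domain of integration. Since
  \<open>Leb {\<phi> \<le> r} = r^q Leb {\<phi> \<le> 1}\<close> and \<open>\<parallel>\<phi>^D\<parallel> \<le> C \<phi>^\<gamma>\<close> for \<open>\<phi> \<le> 1\<close>, the singularity at the origin is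
  integrable as \<open>a \<gamma> > -q\<close>, and the exponential factor takes care of infinity.\<close>

section \<open>Matrix exponentials\<close>

text \<open>The condition on \<open>H - q B\<close> is a strict inequality, so every rate may be
  given up by an epsilon. This allows growth of the matrix exponential to be proved without a Jordan
  form: a vector is described by a product of factors A - l that annihilates it, and each factor
  costs one integration. Only the exponent a has to be nearly sharp. It governs \<psi> at large
  arguments, hence the singularity of the kernel, where it competes with the homogeneous dimension
  q. The exponent b comes from a crude growth bound: where the kernel blows up a smaller exponent is
  milder, and at infinity the tempering beats every power. The probabilistic side is shaped by the
  definition of the integral, in which one sequence of simple functions must serve every Borel set
  A. Hence each estimate is made by a quantity independent of A, and the subsequence is chosen
  before A. The kernel enters \<psi> through its transpose, but the estimates use only its norm,
  which transposition preserves.\<close>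

lemma norm_matrix_vector_le:
  fixes A :: "real^'n^'m"
  shows "norm (A *v x) \<le> norm A * norm x"
proof -
  have "norm (A *v x) \<le> L2_set (\<lambda>i. norm (A$i) * norm x) UNIV"
    unfolding norm_vec_def[of "A *v x"]
    by (rule L2_set_mono) (auto simp: matrix_vector_mul_component Cauchy_Schwarz_ineq2)
  also have "\<dots> = norm A * norm x"
    by (simp add: norm_vec_def[of A] L2_set_left_distrib)
  finally show ?thesis .
qed

lemma norm_transpose_matrix:
  fixes A :: "real^'n^'m"
  shows "norm (transpose A) = norm A"
  unfolding norm_vec_def L2_set_def transpose_def
  by (simp add: sum_nonneg) (rule sum.swap)

lemma norm_matrix_mult_le:
  fixes A :: "real^'n^'m" and B :: "real^'p^'n"
  shows "norm (A ** B) \<le> norm A * norm B"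
proof -
  have row: "(A ** B)$i = transpose B *v (A$i)" for i
    by (simp add: vec_eq_iff matrix_matrix_mult_def matrix_vector_mult_def transpose_def mult.commute)
  have "norm (A ** B) \<le> L2_set (\<lambda>i. norm (A$i) * norm B) UNIV"
    unfolding norm_vec_def[of "A ** B"]
  proof (rule L2_set_mono)
    fix i show "norm ((A ** B)$i) \<le> norm (A$i) * norm B"
      using norm_matrix_vector_le[of "transpose B" "A$i"]
      by (simp add: row norm_transpose_matrix mult.commute)
  qed auto
  also have "\<dots> = norm A * norm B"
    by (simp add: norm_vec_def[of A] L2_set_left_distrib)
  finally show ?thesis .
qed

lemma bounded_bilinear_matrix_vector:
  "bounded_bilinear ((*v) :: real^'n^'m \<Rightarrow> real^'n \<Rightarrow> real^'m)"
  by standard (auto simp: matrix_vector_mult_add_rdistrib matrix_vector_right_distrib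
      scaleR_matrix_vector_assoc matrix_vector_mult_scaleR intro!: exI[of _ 1] norm_matrix_vector_le)

lemma scaleR_matrix_mult_left: "(c *\<^sub>R A) ** B = c *\<^sub>R (A ** B)"
  for A :: "real^'n^'m" and B :: "real^'p^'n"
  by (simp add: vec_eq_iff matrix_matrix_mult_def sum_distrib_left mult.assoc)

lemma scaleR_matrix_mult_right: "A ** (c *\<^sub>R B) = c *\<^sub>R (A ** B)"
  for A :: "real^'n^'m" and B :: "real^'p^'n"
  by (simp add: vec_eq_iff matrix_matrix_mult_def sum_distrib_left mult.left_commute)

lemma matrix_matrix_mult_add_left: "(A + B) ** C = A ** C + B ** C"
  for A B :: "real^'n^'m" and C :: "real^'p^'n"
  by (simp add: vec_eq_iff matrix_matrix_mult_def sum.distrib distrib_right)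

lemma bounded_bilinear_matrix_matrix:
  "bounded_bilinear ((**) :: real^'n^'m \<Rightarrow> real^'p^'n \<Rightarrow> real^'p^'m)"
  by standard (auto simp: scaleR_matrix_mult_left scaleR_matrix_mult_right matrix_add_ldistrib matrix_matrix_mult_add_left
      intro!: exI[of _ 1] norm_matrix_mult_le)

lemma mpow_0 [simp]: "mpow A 0 = mat 1"
  and mpow_Suc: "mpow A (Suc k) = mpow A k ** A"
  by (simp_all add: mpow_def)

lemma mpow_Suc_left: "mpow A (Suc k) = A ** mpow A k"
  by (induction k) (simp_all add: mpow_Suc flip: matrix_mul_assoc)

lemma norm_mpow_le: "norm (mpow A k) \<le> norm (mat 1 :: real^'n^'n) * norm A ^ k"
  for A :: "real^'n^'n"
proof (induction k)
  case (Suc k)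
  have "norm (mpow A (Suc k)) \<le> norm (mpow A k) * norm A"
    unfolding mpow_Suc by (rule norm_matrix_mult_le)
  also have "\<dots> \<le> (norm (mat 1 :: real^'n^'n) * norm A ^ k) * norm A"
    by (rule mult_right_mono[OF Suc]) simp
  finally show ?case by (simp add: mult_ac)
qed simp

text \<open>The logarithmic parameter t = ln c turns \<open>matrix_cpow\<close> into a one-parameter
  group over all reals, so derivatives, limits at minus infinity and scaling laws carry no side
  condition c > 0.\<close>

definition mexp :: "real \<Rightarrow> real^'n^'n \<Rightarrow> real^'n^'n" where
  "mexp t A = (\<Sum>k. (t ^ k / fact k) *\<^sub>R mpow A k)"

lemma matrix_cpow_eq_mexp: "matrix_cpow c A = mexp (ln c) A"
  by (simp add: matrix_cpow_def mexp_def)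

lemma summable_mexp: "summable (\<lambda>k. (t ^ k / fact k) *\<^sub>R mpow A k)"
  for A :: "real^'n^'n"
proof (rule summable_comparison_test)
  show "\<exists>N. \<forall>k\<ge>N. norm ((t ^ k / fact k) *\<^sub>R mpow A k)
      \<le> norm (mat 1 :: real^'n^'n) * ((\<bar>t\<bar> * norm A) ^ k /\<^sub>R fact k)"
  proof (intro exI allI impI)
    fix k :: nat
    have "norm ((t ^ k / fact k) *\<^sub>R mpow A k)
        \<le> \<bar>t\<bar> ^ k / fact k * (norm (mat 1 :: real^'n^'n) * norm A ^ k)"
      by (simp add: power_abs mult_left_mono norm_mpow_le divide_right_mono)
    then show "norm ((t ^ k / fact k) *\<^sub>R mpow A k)
      \<le> norm (mat 1 :: real^'n^'n) * ((\<bar>t\<bar> * norm A) ^ k /\<^sub>R fact k)"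
      by (simp add: power_mult_distrib field_simps)
  qed
  show "summable (\<lambda>k. norm (mat 1 :: real^'n^'n) * ((\<bar>t\<bar> * norm A) ^ k /\<^sub>R fact k))"
    by (intro summable_mult summable_exp_generic)
qed

text \<open>Each entry is an everywhere convergent real power series; this reduces differentiation
  of the matrix exponential to termwise differentiation of scalar series.\<close>

lemma mexp_nth_sums: "(\<lambda>k. mpow A k $ i $ j / fact k * t ^ k) sums (mexp t A $ i $ j)"
  for A :: "real^'n^'n"
proof -
  have bl: "bounded_linear (\<lambda>M::real^'n^'n. M $ i $ j)"
    by (intro bounded_linear_compose[OF bounded_linear_vec_nth bounded_linear_vec_nth])
  show ?thesis
    using bounded_linear.sums[OF bl summable_sums[OF summable_mexp[of t A]]]
    by (simp add: mexp_def field_simps)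
qed

lemma mexp_0 [simp]: "mexp 0 A = mat 1"
proof -
  have "(\<lambda>k. (0 ^ k / fact k) *\<^sub>R mpow A k) = (\<lambda>k. if k = 0 then mat 1 else 0)"
    by auto
  then show ?thesis
    unfolding mexp_def using sums_single[of 0 "\<lambda>_. mat 1 :: real^'a^'a"] by (simp add: sums_iff)
qed

lemma mexp_commute:
  fixes A :: "real^'n^'n"
  shows "A ** mexp t A = mexp t A ** A"
proof -
  interpret bounded_bilinear "(**) :: real^'n^'n \<Rightarrow> real^'n^'n \<Rightarrow> real^'n^'n"
    by (rule bounded_bilinear_matrix_matrix)
  have "(\<lambda>k. A ** ((t ^ k / fact k) *\<^sub>R mpow A k)) sums (A ** mexp t A)"
    unfolding mexp_def by (intro bounded_linear.sums[OF bounded_linear_right] summable_sums summable_mexp)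
  moreover have "(\<lambda>k. ((t ^ k / fact k) *\<^sub>R mpow A k) ** A) sums (mexp t A ** A)"
    unfolding mexp_def by (intro bounded_linear.sums[OF bounded_linear_left] summable_sums summable_mexp)
  moreover have "A ** ((t ^ k / fact k) *\<^sub>R mpow A k) = ((t ^ k / fact k) *\<^sub>R mpow A k) ** A" for k
    by (simp add: scaleR_matrix_mult_left scaleR_matrix_mult_right flip: mpow_Suc mpow_Suc_left)
  ultimately show ?thesis
    by (simp add: sums_iff)
qed

lemma has_vector_derivative_componentwise_matrix:
  fixes F :: "real \<Rightarrow> real^'n^'m"
  assumes "\<And>i j. ((\<lambda>t. F t $ i $ j) has_real_derivative (D $ i $ j)) (at t)"
  shows "(F has_vector_derivative D) (at t)"
proof -
  have "((\<lambda>t. F t \<bullet> b) has_vector_derivative (D \<bullet> b)) (at t)" if "b \<in> Basis" for b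
  proof -
    obtain i j where "b = axis i (axis j 1)"
      using \<open>b \<in> Basis\<close> by (auto simp: Basis_vec_def)
    then show ?thesis
      using assms[of i j] by (simp add: inner_axis has_real_derivative_iff_has_vector_derivative)
  qed
  then show ?thesis
    by (subst has_vector_derivative_def, subst has_derivative_componentwise_within)
       (auto simp: has_vector_derivative_def)
qed

lemma mexp_has_vector_derivative:
  "((\<lambda>t. mexp t A) has_vector_derivative (mexp t A ** A)) (at t)"
proof (rule has_vector_derivative_componentwise_matrix)
  fix i j
  define c where "c = (\<lambda>k. mpow A k $ i $ j / fact k)"
  have sm: "summable (\<lambda>k. c k * s ^ k)" for s
    using mexp_nth_sums[of A i j s] by (auto simp: c_def sums_iff)
  have eq: "(\<lambda>t. mexp t A $ i $ j) = (\<lambda>t. \<Sum>k. c k * t ^ k)"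
    using mexp_nth_sums[of A i j] by (auto simp: c_def sums_iff)
  have "(\<lambda>k. \<Sum>l\<in>UNIV. (mpow A k $ i $ l / fact k * t ^ k) * A $ l $ j) sums (mexp t A ** A) $ i $ j"
    unfolding matrix_matrix_mult_def vec_lambda_beta by (intro sums_sum sums_mult2 mexp_nth_sums)
  \<comment> \<open>The factor k + 1 in \<open>diffs\<close> cancels against the factorial, which
    leaves an entry of \<open>mpow A (Suc k)\<close>, a row of \<open>mpow A k\<close> times a
    column of A.\<close>
  moreover have "(\<Sum>l\<in>UNIV. (mpow A k $ i $ l / fact k * t ^ k) * A $ l $ j) = diffs c k * t ^ k" for k
  proof -
    have "diffs c k = mpow A (Suc k) $ i $ j / fact k"
      by (simp add: diffs_def c_def del: of_nat_Suc)
    then show ?thesis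
      by (simp add: mpow_Suc matrix_matrix_mult_def sum_distrib_left sum_divide_distrib mult_ac)
  qed
  ultimately have "(mexp t A ** A) $ i $ j = (\<Sum>k. diffs c k * t ^ k)"
    by (simp add: sums_iff)
  then show "((\<lambda>t. mexp t A $ i $ j) has_real_derivative (mexp t A ** A) $ i $ j) (at t)"
    unfolding eq using termdiffs_strong_converges_everywhere[OF sm, of t] by simp
qed

text \<open>The derivative in t vanishes because A commutes with its exponential, and t = 0
  identifies the constant. This mixed form yields invertibility (s = 0) and then the group law, with
  no Cauchy product of series.\<close>

lemma mexp_uminus_mult: "mexp (-t) A ** mexp (t + s) A = mexp s A"
  for A :: "real^'n^'n"
proof -
  interpret bounded_bilinear "(**) :: real^'n^'n \<Rightarrow> real^'n^'n \<Rightarrow> real^'n^'n"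
    by (rule bounded_bilinear_matrix_matrix)
  have "\<exists>c. \<forall>t\<in>UNIV. mexp (-t) A ** mexp (t + s) A = c"
  proof (rule has_vector_derivative_zero_constant)
    fix t :: real
    have 1: "((\<lambda>t. mexp (-t) A) has_vector_derivative - (mexp (-t) A ** A)) (at t)"
      using vector_diff_chain_at[of uminus "-1" t "\<lambda>t. mexp t A" "mexp (-t) A ** A"]
        has_vector_derivative_minus[OF has_vector_derivative_id[of "at t"]]
      by (simp add: o_def mexp_has_vector_derivative)
    have 2: "((\<lambda>t. mexp (t + s) A) has_vector_derivative (mexp (t + s) A ** A)) (at t)"
      using vector_diff_chain_at[of "\<lambda>t. t + s" 1 t "\<lambda>t. mexp t A" "mexp (t + s) A ** A"]
        has_vector_derivative_add[OF has_vector_derivative_id[of "at t"] has_vector_derivative_const[of s]]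
      by (simp add: o_def mexp_has_vector_derivative)
    have "mexp (-t) A ** (mexp (t + s) A ** A) + (- (mexp (-t) A ** A)) ** mexp (t + s) A = 0"
      by (simp add: minus_left mexp_commute flip: matrix_mul_assoc)
    then show "((\<lambda>t. mexp (-t) A ** mexp (t + s) A) has_vector_derivative 0) (at t within UNIV)"
      using has_vector_derivative[OF 1 2] by simp
  qed auto
  then obtain c where c: "\<And>t. mexp (-t) A ** mexp (t + s) A = c" by auto
  from c[of 0] c[of t] show ?thesis by simp
qed

lemma mexp_minus_left [simp]: "mexp (-t) A ** mexp t A = mat 1"
  using mexp_uminus_mult[of t A 0] by simp

lemma mexp_minus_right [simp]: "mexp t A ** mexp (-t) A = mat 1"
  using mexp_minus_left[of "-t" A] by simp

lemma mexp_add: "mexp (t + s) A = mexp t A ** mexp s A"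
proof -
  have "mexp t A ** mexp s A = (mexp t A ** mexp (-t) A) ** mexp (t + s) A"
    by (simp only: mexp_uminus_mult flip: matrix_mul_assoc)
  then show ?thesis by simp
qed

lemma mpow_uminus: "mpow (-A) k = (-1)^k *\<^sub>R mpow A k" for A :: "real^'n^'n"
proof -
  interpret bounded_bilinear "(**) :: real^'n^'n \<Rightarrow> real^'n^'n \<Rightarrow> real^'n^'n"
    by (rule bounded_bilinear_matrix_matrix)
  show ?thesis
    by (induction k) (simp_all add: mpow_Suc minus_right scaleR_matrix_mult_left)
qed

lemma mexp_uminus: "mexp t (-A) = mexp (-t) A"
  by (simp add: mexp_def mpow_uminus power_minus[of t] mult.commute)

lemma continuous_on_mexp [continuous_intros]:
  assumes "continuous_on S f"
  shows "continuous_on S (\<lambda>x. mexp (f x) A)"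
proof -
  have "continuous_on UNIV (\<lambda>t. mexp t A)"
    by (intro continuous_at_imp_continuous_on ballI
        has_vector_derivative_continuous[OF mexp_has_vector_derivative])
  from continuous_on_compose2[OF this assms] show ?thesis by simp
qed

section \<open>Eigenvalues and growth of the matrix exponential\<close>

definition mshift :: "real^'n^'n \<Rightarrow> complex \<Rightarrow> complex^'n \<Rightarrow> complex^'n" where
  "mshift A l v = cmat A *v v - l *s v"

text \<open>A polynomial in A given by the list of its roots. Such products commute, so factors may
  be reordered freely.\<close>

primrec mkill :: "real^'n^'n \<Rightarrow> complex list \<Rightarrow> complex^'n \<Rightarrow> complex^'n" where
  "mkill A [] v = v"
| "mkill A (l # ls) v = mkill A ls (mshift A l v)"

lemma mshift_add: "mshift A l (v + w) = mshift A l v + mshift A l w"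
  by (simp add: mshift_def matrix_vector_right_distrib vector_add_ldistrib)

lemma mshift_scale: "mshift A l (c *s v) = c *s mshift A l v"
  by (simp add: mshift_def vector_scalar_commute vector_ssub_ldistrib vector_smult_assoc mult.commute)

lemma mshift_0 [simp]: "mshift A l 0 = 0"
  by (simp add: mshift_def)

lemma mshift_matrix: "mshift A l (cmat A *v v) = cmat A *v mshift A l v"
  by (simp add: mshift_def vector_scalar_commute matrix_vector_mult_diff_distrib)

lemma mshift_commute: "mshift A l (mshift A m v) = mshift A m (mshift A l v)"
  by (simp add: mshift_def vector_scalar_commute matrix_vector_mult_diff_distrib vector_ssub_ldistrib
      vector_smult_assoc mult.commute)

lemma mkill_mshift: "mkill A ls (mshift A l v) = mshift A l (mkill A ls v)"
  by (induction ls arbitrary: v) (simp, metis mkill.simps(2) mshift_commute)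

lemma mkill_append: "mkill A (ls @ ms) v = mkill A ms (mkill A ls v)"
  by (induction ls arbitrary: v) simp_all

lemma mkill_commute: "mkill A ls (mkill A ms v) = mkill A ms (mkill A ls v)"
  by (induction ls arbitrary: v) (simp_all flip: mkill_mshift[of A ms])

lemma mkill_0 [simp]: "mkill A ls 0 = 0"
  by (induction ls) simp_all

lemma mkill_add: "mkill A ls (v + w) = mkill A ls v + mkill A ls w"
  by (induction ls arbitrary: v w) (simp_all add: mshift_add)

lemma mkill_scale: "mkill A ls (c *s v) = c *s mkill A ls v"
  by (induction ls arbitrary: v) (simp_all add: mshift_scale)

lemma mkill_sum: "mkill A ls (sum f S) = (\<Sum>i\<in>S. mkill A ls (f i))"
  by (induction S rule: infinite_finite_induct) (simp_all add: mkill_add)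

lemma mkill_eigenvector:
  assumes "cmat A *v v = l *s v"
  shows "mkill A ms v = (\<Prod>m\<leftarrow>ms. l - m) *s v"
proof (induction ms)
  case (Cons m ms)
  have "mshift A m v = (l - m) *s v"
    using assms by (simp add: mshift_def vector_sub_rdistrib)
  then show ?case by (simp only: mkill.simps mkill_scale Cons vector_smult_assoc) simp
qed simp

section \<open>Annihilating polynomials of a vector and finiteness of the spectrum\<close>

definition papply :: "real^'n^'n \<Rightarrow> complex^'n \<Rightarrow> complex poly \<Rightarrow> complex^'n" where
  "papply A v p = fold_coeffs (\<lambda>a w. a *s v + cmat A *v w) p 0"

lemma papply_0 [simp]: "papply A v 0 = 0"
  by (simp add: papply_def)

lemma papply_pCons: "papply A v (pCons a p) = a *s v + cmat A *v papply A v p"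
  by (cases "p = 0 \<and> a = 0") (auto simp: papply_def)

lemma papply_add: "papply A v (p + q) = papply A v p + papply A v q"
  by (induction p q rule: poly_induct2)
     (simp_all add: papply_pCons matrix_vector_right_distrib vector_sadd_rdistrib)

lemma papply_smult: "papply A v (smult c p) = c *s papply A v p"
  by (induction p)
     (simp_all add: papply_pCons vector_add_ldistrib vector_smult_assoc vector_scalar_commute)

lemma papply_sum: "papply A v (sum f S) = (\<Sum>i\<in>S. papply A v (f i))"
  by (induction S rule: infinite_finite_induct) (simp_all add: papply_add)

lemma papply_monom: "papply A v (monom c i) = c *s (((*v) (cmat A)) ^^ i) v"
  by (induction i) (simp_all add: monom_0 monom_Suc papply_pCons vector_scalar_commute)

lemma papply_mshift: "papply A (mshift A l v) p = mshift A l (papply A v p)"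
  by (induction p) (simp_all add: papply_pCons mshift_add mshift_scale mshift_matrix)

lemma papply_linear_factor: "papply A v ([:- l, 1:] * q) = mshift A l (papply A v q)"
proof -
  have eq: "[:- l, 1:] * q = pCons 0 q + smult (- l) q"
    by simp
  show ?thesis
    unfolding eq by (simp add: papply_add papply_pCons papply_smult mshift_def del: smult_minus_left)
qed

text \<open>The vectors A^i v with i \<le> N are N + 1 in number, one more than the real dimension
  of the complex space, so a linear relation among them exists; its coefficients form the
  polynomial.\<close>

lemma papply_annihilator_exists: "\<exists>p. p \<noteq> 0 \<and> papply A v p = 0"
proof -
  define w where "w i = (((*v) (cmat A)) ^^ i) v" for i
  define N where "N = DIM(complex^'a)"
  show ?thesis
  proof (cases "inj_on w {..N}")
    \<comment> \<open>\<open>dependent\<close> is a property of sets, so a repetition in the orbit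
      is a case of its own, settled by the difference of two monomials.\<close>
    case False
    then obtain i j where "i \<noteq> j" "w i = w j" by (auto simp: inj_on_def)
    define p :: "complex poly" where "p = monom 1 i + monom (-1) j"
    have "coeff p i \<noteq> 0" using \<open>i \<noteq> j\<close> by (simp add: p_def)
    then have "p \<noteq> 0" by auto
    moreover have "papply A v p = 0"
      using \<open>w i = w j\<close> by (simp add: p_def papply_add papply_monom w_def)
    ultimately show ?thesis by blast
  next
    case True
    have "card (w ` {..N}) = Suc N" using True by (simp add: card_image)
    then have "dependent (w ` {..N})"
      using independent_bound[of "w ` {..N}"] by (auto simp: N_def)
    then obtain u x where u: "x \<in> w ` {..N}" "u x \<noteq> (0::real)" "(\<Sum>x\<in>w ` {..N}. u x *\<^sub>R x) = 0"
      by (auto simp: real_vector.dependent_finite)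
    then obtain j where j: "j \<le> N" "u (w j) \<noteq> 0" by auto
    define p where "p = (\<Sum>i\<le>N. monom (complex_of_real (u (w i))) i)"
    have "coeff p j = u (w j)"
      using j(1) by (simp add: p_def coeff_sum)
    then have "p \<noteq> 0" using j(2) by auto
    moreover have "papply A v p = (\<Sum>i\<le>N. u (w i) *\<^sub>R w i)"
      by (auto simp: p_def papply_sum papply_monom vec_eq_iff scaleR_conv_of_real[where 'a=complex] simp flip: w_def)
    then have "papply A v p = 0"
      using u(3) True by (simp add: sum.reindex)
    ultimately show ?thesis by blast
  qed
qed

text \<open>The fundamental theorem of algebra splits off one root at a time, and the factor is
  moved from the polynomial to the vector; hence v varies in the induction. A nonzero constant
  polynomial forces v = 0.\<close>

lemma mkill_exists_of_papply:
  assumes "p \<noteq> 0" "papply A v p = 0"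
  shows "\<exists>ls. mkill A ls v = 0"
  using assms
proof (induction "degree p" arbitrary: p v)
  case 0
  then obtain c where "p = [:c:]" by (metis degree_eq_zeroE)
  with 0 have "v = 0" by (auto simp: papply_pCons)
  then show ?case by (intro exI[of _ "[]"]) simp
next
  case (Suc d)
  then have "\<not> constant (poly p)" by (simp add: constant_degree)
  then obtain z where "poly p z = 0" using fundamental_theorem_of_algebra by blast
  then obtain q where q: "p = [:- z, 1:] * q" by (auto simp: poly_eq_0_iff_dvd)
  have "q \<noteq> 0" using Suc.prems q by auto
  then have "degree q = d" using Suc.hyps(2) by (simp add: q degree_mult_eq del: mult_pCons_left)
  moreover have "papply A (mshift A z v) q = 0"
    using Suc.prems(2) by (simp only: q papply_mshift papply_linear_factor)
  ultimately obtain ls where "mkill A ls (mshift A z v) = 0"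
    using Suc.hyps(1) \<open>q \<noteq> 0\<close> by blast
  then show ?case by (intro exI[of _ "z # ls"]) simp
qed

lemma mkill_restrict_eigenvalues:
  assumes "mkill A ls v = 0"
  shows "\<exists>ms. set ms \<subseteq> eigenvalues A \<and> mkill A ms v = 0"
  using assms
proof (induction ls arbitrary: v)
  case Nil
  then show ?case by (intro exI[of _ "[]"]) simp
next
  case (Cons l ls)
  then obtain ms where ms: "set ms \<subseteq> eigenvalues A" "mkill A ms (mshift A l v) = 0" by auto
  show ?case
  proof (cases "mkill A ms v = 0")
    case True
    with ms show ?thesis by blast
  next
    case False
    have "mshift A l (mkill A ms v) = 0" using ms(2) by (simp add: mkill_mshift)
    then have "l \<in> eigenvalues A" using False by (auto simp: eigenvalues_def mshift_def)
    with ms show ?thesis by (intro exI[of _ "l # ms"]) auto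
  qed
qed

lemma mkill_eigenvalues_exists: "\<exists>ls. set ls \<subseteq> eigenvalues A \<and> mkill A ls v = 0"
proof -
  obtain p where "p \<noteq> 0" "papply A v p = 0" using papply_annihilator_exists by blast
  then obtain ls where "mkill A ls v = 0" using mkill_exists_of_papply by blast
  then show ?thesis by (rule mkill_restrict_eigenvalues)
qed

text \<open>The empty product cannot annihilate a nonzero vector. Nonemptiness and finiteness
  together make the \<open>Min\<close> in \<open>min_re_eig\<close> attained.\<close>

lemma eigenvalues_nonempty: "eigenvalues A \<noteq> {}" for A :: "real^'n^'n"
proof -
  obtain ls where "set ls \<subseteq> eigenvalues A" "mkill A ls (axis undefined 1) = 0"
    using mkill_eigenvalues_exists by blast
  moreover have "axis undefined 1 \<noteq> (0 :: complex^'n)" by (simp add: axis_eq_0_iff)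
  ultimately show ?thesis by (cases ls) auto
qed

text \<open>One product of factors annihilates a basis and therefore every vector. On an eigenvector
  for l it is multiplication by the product of the l - m, so l must occur in the list.\<close>

lemma finite_eigenvalues: "finite (eigenvalues A)" for A :: "real^'n^'n"
proof -
  have "\<exists>ls. \<forall>v\<in>S. mkill A ls v = 0" if "finite S" for S
    using that
  proof induction
    case (insert v S)
    then obtain ls where ls: "\<forall>v\<in>S. mkill A ls v = 0" by blast
    obtain ms where "mkill A ms v = 0" using mkill_eigenvalues_exists by blast
    then have "mkill A (ls @ ms) v = 0"
      by (simp add: mkill_append mkill_commute[of A ms])
    with ls show ?case by (intro exI[of _ "ls @ ms"]) (auto simp: mkill_append)
  qed auto
  from this[of "range (\<lambda>i. axis i 1)"] obtain ls where ls: "\<And>i. mkill A ls (axis i 1) = 0" by auto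
  have all0: "mkill A ls v = 0" for v
  proof -
    have "mkill A ls v = mkill A ls (\<Sum>i\<in>UNIV. v$i *s axis i 1)" by (simp add: basis_expansion)
    also have "\<dots> = 0" by (simp add: mkill_sum mkill_scale ls)
    finally show ?thesis .
  qed
  have "eigenvalues A \<subseteq> set ls"
  proof
    fix l assume "l \<in> eigenvalues A"
    then obtain v where v: "v \<noteq> 0" "cmat A *v v = l *s v" by (auto simp: eigenvalues_def)
    then have "(\<Prod>m\<leftarrow>ls. l - m) = 0"
      using mkill_eigenvector[OF v(2)] all0[of v] by (auto simp: vector_mul_eq_0)
    then show "l \<in> set ls" by (auto simp: prod_list_zero_iff)
  qed
  then show ?thesis by (rule finite_subset) simp
qed

lemma min_re_eig_le: "l \<in> eigenvalues A \<Longrightarrow> min_re_eig A \<le> Re l"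
  by (simp add: min_re_eig_def finite_eigenvalues)

lemma min_re_eig_attained: "\<exists>l\<in>eigenvalues A. Re l = min_re_eig A"
proof -
  have "min_re_eig A \<in> Re ` eigenvalues A"
    unfolding min_re_eig_def by (rule Min_in) (auto simp: finite_eigenvalues eigenvalues_nonempty)
  then show ?thesis by auto
qed

lemma eigenvalues_uminus: "eigenvalues (- A) = uminus ` eigenvalues A"
proof -
  have *: "cmat (- A) *v v = - (cmat A *v v)" for A :: "real^'n^'n" and v
    by (simp add: vec_eq_iff matrix_vector_mult_def cmat_def sum_negf)
  have **: "- l \<in> eigenvalues (- A)" if "l \<in> eigenvalues A" for A :: "real^'n^'n" and l
    using that by (force simp: eigenvalues_def *)
  show ?thesis
    using **[of _ A] **[of _ "- A"] by (force simp: image_iff)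
qed

lemma cmat_mult: "cmat (A ** B) = cmat A ** cmat B"
  by (simp add: vec_eq_iff cmat_def matrix_matrix_mult_def)

lemma cmat_mat_1: "cmat (mat 1) = mat 1"
  by (simp add: vec_eq_iff cmat_def mat_def)

section \<open>Growth and decay rates of the matrix exponential\<close>

lemma norm_vector_smult: "norm (c *s v) = norm c * norm v" for v :: "complex^'n"
  by (simp add: norm_vec_def norm_mult L2_set_right_distrib)

lemma bounded_bilinear_vector_smult:
  "bounded_bilinear ((*s) :: complex \<Rightarrow> complex^'n \<Rightarrow> complex^'n)"
  by standard (auto simp: vec_eq_iff algebra_simps norm_vector_smult intro!: exI[of _ 1])

lemma has_vector_derivative_cmat_mexp:
  "((\<lambda>t. cmat (mexp t A) *v v) has_vector_derivative (cmat (mexp t A) *v (cmat A *v v))) (at t)"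
  for A :: "real^'n^'n"
proof -
  have "linear (\<lambda>M::real^'n^'n. cmat M *v v)"
    by (rule linearI)
       (simp_all add: vec_eq_iff cmat_def matrix_vector_mult_def sum.distrib algebra_simps
         sum_distrib_left scaleR_conv_of_real[where 'a=complex])
  then have "bounded_linear (\<lambda>M::real^'n^'n. cmat M *v v)"
    by (simp add: linear_conv_bounded_linear)
  from bounded_linear.has_vector_derivative[OF this mexp_has_vector_derivative[of A t]]
  show ?thesis by (simp add: cmat_mult matrix_vector_mul_assoc)
qed

text \<open>With w = (A - l) v, the curve exp(- l t) exp(t A) v has derivative exp(- l t) exp(t A)
  w, and w is annihilated by a shorter list. Integrating the inductive bound keeps the rate
  \<rho>.\<close>

lemma cmat_mexp_growth:
  assumes "mkill A ls v = 0" "\<forall>l\<in>set ls. Re l < \<rho>"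
  shows "\<exists>C\<ge>0. \<forall>t\<ge>0. norm (cmat (mexp t A) *v v) \<le> C * exp (\<rho> * t)"
  using assms
proof (induction ls arbitrary: v)
  case Nil
  then show ?case by (intro exI[of _ 0]) simp
next
  case (Cons l ls)
  interpret bounded_bilinear "(*s) :: complex \<Rightarrow> complex^'a \<Rightarrow> complex^'a"
    by (rule bounded_bilinear_vector_smult)
  define w where "w = mshift A l v"
  \<comment> \<open>The strict gap between \<rho> and Re l makes the integral of exp(\<delta> t)
    again a multiple of itself, so no polynomial factors in t accumulate.\<close>
  define \<delta> where "\<delta> = \<rho> - Re l"
  have "\<delta> > 0" using Cons.prems by (simp add: \<delta>_def)
  from Cons obtain C where C: "C \<ge> 0" "\<And>t. t \<ge> 0 \<Longrightarrow> norm (cmat (mexp t A) *v w) \<le> C * exp (\<rho> * t)"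
    by (force simp: w_def)
  define u where "u t = exp (- l * complex_of_real t) *s (cmat (mexp t A) *v v)" for t
  have u': "(u has_vector_derivative (exp (- l * complex_of_real t) *s (cmat (mexp t A) *v w))) (at t)" for t
  proof -
    have "((\<lambda>t. exp (- l * complex_of_real t)) has_vector_derivative (- l * exp (- l * complex_of_real t))) (at t)"
      by (rule has_vector_derivative_real_field) (auto intro!: derivative_eq_intros)
    from has_vector_derivative[OF this has_vector_derivative_cmat_mexp[of A v t]]
    show ?thesis
      unfolding u_def w_def mshift_def
      by (simp add: matrix_vector_mult_diff_distrib vector_scalar_commute vector_ssub_ldistrib
          vector_smult_assoc mult.commute)
  qed
  have u_bound: "norm (u t - u 0) \<le> C / \<delta> * exp (\<delta> * t)" if "t \<ge> 0" for t
  proof (cases "t = 0")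
    case False
    have "norm (u t - u 0) \<le> C / \<delta> * exp (\<delta> * t) - C / \<delta> * exp (\<delta> * 0)"
    proof (rule differentiable_bound_general)
      show "0 < t" using that False by simp
      show "continuous_on {0..t} u"
        by (intro continuous_at_imp_continuous_on ballI has_vector_derivative_continuous[OF u'])
      show "continuous_on {0..t} (\<lambda>t. C / \<delta> * exp (\<delta> * t))"
        by (intro continuous_intros)
      fix x :: real assume "0 < x"
      show "(u has_vector_derivative (exp (- l * complex_of_real x) *s (cmat (mexp x A) *v w))) (at x)"
        by (rule u')
      show "((\<lambda>t. C / \<delta> * exp (\<delta> * t)) has_vector_derivative (C * exp (\<delta> * x))) (at x)"
        unfolding has_real_derivative_iff_has_vector_derivative[symmetric]
        using \<open>\<delta> > 0\<close> by (auto intro!: derivative_eq_intros)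
      have "norm (exp (- l * complex_of_real x) *s (cmat (mexp x A) *v w))
          \<le> exp (- Re l * x) * (C * exp (\<rho> * x))"
        using C(2)[of x] \<open>0 < x\<close> by (simp add: norm_vector_smult)
      also have "\<dots> = C * exp (\<delta> * x)"
        by (simp add: \<delta>_def left_diff_distrib exp_diff exp_minus field_simps)
      finally show "norm (exp (- l * complex_of_real x) *s (cmat (mexp x A) *v w)) \<le> C * exp (\<delta> * x)" .
    qed
    also have "\<dots> \<le> C / \<delta> * exp (\<delta> * t)" using C(1) \<open>\<delta> > 0\<close> by simp
    finally show ?thesis .
  qed (use C(1) \<open>\<delta> > 0\<close> in simp)
  have "norm (cmat (mexp t A) *v v) \<le> (norm v + C / \<delta>) * exp (\<rho> * t)" if "t \<ge> 0" for t
  proof -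
    have "u 0 = v" by (simp add: u_def cmat_mat_1)
    then have "norm (u t) \<le> norm v + C / \<delta> * exp (\<delta> * t)"
      using u_bound[OF that] norm_triangle_sub[of "u t" v] by simp
    moreover have "norm (u t) = exp (- Re l * t) * norm (cmat (mexp t A) *v v)"
      by (simp add: u_def norm_vector_smult)
    ultimately have "exp (- Re l * t) * norm (cmat (mexp t A) *v v) \<le> norm v + C / \<delta> * exp (\<delta> * t)"
      by simp
    then have "exp (Re l * t) * (exp (- Re l * t) * norm (cmat (mexp t A) *v v))
        \<le> exp (Re l * t) * (norm v + C / \<delta> * exp (\<delta> * t))"
      by (rule mult_left_mono) simp
    then have "norm (cmat (mexp t A) *v v) \<le> exp (Re l * t) * norm v + C / \<delta> * exp (\<rho> * t)"
    proof -
      have "exp (Re l * t) * exp (\<delta> * t) = exp (\<rho> * t)"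
        by (simp add: \<delta>_def algebra_simps flip: exp_add)
      moreover have "exp (Re l * t) * exp (- Re l * t) = 1"
        by (simp flip: exp_add)
      ultimately show "norm (cmat (mexp t A) *v v) \<le> exp (Re l * t) * norm v + C / \<delta> * exp (\<rho> * t)"
        if "exp (Re l * t) * (exp (- Re l * t) * norm (cmat (mexp t A) *v v))
          \<le> exp (Re l * t) * (norm v + C / \<delta> * exp (\<delta> * t))"
        using that
        by (metis (no_types, opaque_lifting) distrib_left mult.assoc mult.left_commute mult_1_left)
    qed
    also have "\<dots> \<le> exp (\<rho> * t) * norm v + C / \<delta> * exp (\<rho> * t)"
      using \<open>\<delta> > 0\<close> that by (auto simp: \<delta>_def intro!: mult_right_mono)
    finally show ?thesis by (simp add: algebra_simps)
  qed
  then show ?case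
    using C(1) \<open>\<delta> > 0\<close> by (intro exI[of _ "norm v + C / \<delta>"]) auto
qed

lemma mexp_growth:
  fixes A :: "real^'n^'n"
  assumes "\<forall>l\<in>eigenvalues A. Re l < \<rho>"
  shows "\<exists>C>0. \<forall>t\<ge>0. norm (mexp t A) \<le> C * exp (\<rho> * t)"
proof -
  have "\<exists>C\<ge>0. \<forall>t\<ge>0. norm (cmat (mexp t A) *v axis j 1) \<le> C * exp (\<rho> * t)" for j
    using mkill_eigenvalues_exists[of A "axis j 1"] cmat_mexp_growth[of A _ "axis j 1" \<rho>] assms by blast
  then obtain C where C: "\<And>j. C j \<ge> 0"
      "\<And>j t. t \<ge> 0 \<Longrightarrow> norm (cmat (mexp t A) *v axis j 1) \<le> C j * exp (\<rho> * t)"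
    by metis
  have entry: "\<bar>mexp t A $ i $ j\<bar> \<le> C j * exp (\<rho> * t)" if "t \<ge> 0" for t i j
  proof -
    have "\<bar>mexp t A $ i $ j\<bar> = norm ((cmat (mexp t A) *v axis j 1) $ i)"
      by (simp add: matrix_vector_mult_def cmat_def axis_def if_distrib cong: if_cong)
    also have "\<dots> \<le> norm (cmat (mexp t A) *v axis j 1)" by (rule Finite_Cartesian_Product.norm_nth_le)
    finally show ?thesis using C(2)[OF that, of j] by linarith
  qed
  have "norm (mexp t A) \<le> (\<Sum>i\<in>(UNIV::'n set). \<Sum>j\<in>UNIV. C j) * exp (\<rho> * t)" if "t \<ge> 0" for t
  proof -
    have "norm (mexp t A) \<le> (\<Sum>i\<in>UNIV. norm (mexp t A $ i))"
      unfolding norm_vec_def[of "mexp t A"] by (rule L2_set_le_sum) simp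
    also have "\<dots> \<le> (\<Sum>i\<in>UNIV. \<Sum>j\<in>UNIV. \<bar>mexp t A $ i $ j\<bar>)"
      by (intro sum_mono norm_le_l1_cart)
    also have "\<dots> \<le> (\<Sum>i\<in>(UNIV::'n set). \<Sum>j\<in>UNIV. C j * exp (\<rho> * t))"
      by (intro sum_mono entry that)
    finally show ?thesis by (simp add: sum_distrib_right mult.assoc)
  qed
  moreover have "(\<Sum>i\<in>(UNIV::'n set). \<Sum>j\<in>UNIV. C j) \<ge> 0" by (intro sum_nonneg C)
  ultimately show ?thesis
    by (intro exI[of _ "(\<Sum>i\<in>(UNIV::'n set). \<Sum>j\<in>UNIV. C j) + 1"] conjI allI impI)
       (auto simp: distrib_right add_increasing2)
qed

text \<open>Some positive rate suffices in two places: for small arguments of \<psi>, and for the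
  kernel at large \<phi>, where tempering absorbs any power.\<close>

lemma mexp_growth_all:
  fixes A :: "real^'n^'n"
  shows "\<exists>C>0. \<exists>\<rho>>0. \<forall>t\<ge>0. norm (mexp t A) \<le> C * exp (\<rho> * t)"
proof -
  obtain \<rho> where "\<rho> > 0" "\<forall>l\<in>eigenvalues A. Re l < \<rho>"
  proof
    show "0 < Max (insert 0 (Re ` eigenvalues A)) + 1"
      using Max_ge[of "insert 0 (Re ` eigenvalues A)" 0] by (simp add: finite_eigenvalues del: Max_ge)
    show "\<forall>l\<in>eigenvalues A. Re l < Max (insert 0 (Re ` eigenvalues A)) + 1"
    proof
      fix l assume "l \<in> eigenvalues A"
      then have "Re l \<le> Max (insert 0 (Re ` eigenvalues A))"
        by (intro Max_ge) (auto simp: finite_eigenvalues)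
      then show "Re l < Max (insert 0 (Re ` eigenvalues A)) + 1" by simp
    qed
  qed
  then show ?thesis using mexp_growth[of A \<rho>] by blast
qed

text \<open>This is the growth bound for -A with time reversed. The strict inequality for \<gamma>
  leaves room for nontrivial Jordan blocks.\<close>

lemma mexp_decay:
  fixes A :: "real^'n^'n"
  assumes "\<gamma> < min_re_eig A"
  shows "\<exists>C>0. \<forall>t\<le>0. norm (mexp t A) \<le> C * exp (\<gamma> * t)"
proof -
  have "\<forall>l\<in>eigenvalues (- A). Re l < - \<gamma>"
    using assms min_re_eig_le[of _ A] by (force simp: eigenvalues_uminus)
  then obtain C where "C > 0" and C: "\<And>t. t \<ge> 0 \<Longrightarrow> norm (mexp t (- A)) \<le> C * exp (- \<gamma> * t)"
    using mexp_growth[of "- A" "- \<gamma>"] by blast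
  have "norm (mexp t A) \<le> C * exp (\<gamma> * t)" if "t \<le> 0" for t
    using C[of "- t"] that by (simp add: mexp_uminus)
  with \<open>C > 0\<close> show ?thesis by blast
qed

section \<open>Determinant, volume and polar coordinates\<close>

text \<open>In the Leibniz expansion the product rule leaves out one factor at a time; at the
  identity only the identity permutation has all remaining factors nonzero.\<close>

lemma det_has_real_derivative_at_identity:
  fixes F :: "real \<Rightarrow> real^'n^'n"
  assumes F0: "F 0 = mat 1"
    and F': "\<And>i j. ((\<lambda>t. F t $ i $ j) has_real_derivative (D $ i $ j)) (at 0)"
  shows "((\<lambda>t. det (F t)) has_real_derivative mtrace D) (at 0)"
proof -
  let ?P = "{p. p permutes (UNIV :: 'n set)}"
  let ?d = "\<lambda>p. of_int (sign p) * (\<Sum>i\<in>UNIV. D $ i $ p i * (\<Prod>j\<in>UNIV - {i}. F 0 $ j $ p j))"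
  have "((\<lambda>t. det (F t)) has_real_derivative (\<Sum>p\<in>?P. ?d p)) (at 0)"
    unfolding det_def
    by (intro DERIV_sum DERIV_cmult has_field_derivative_prod F')
  moreover have "(\<Sum>p\<in>?P. ?d p) = (\<Sum>p\<in>{id}. ?d p)"
  proof (rule sum.mono_neutral_right)
    show "finite ?P" by (simp add: finite_permutations)
    show "{id} \<subseteq> ?P" by (simp add: permutes_id)
    show "\<forall>p\<in>?P - {id}. ?d p = 0"
    proof
      fix p assume p: "p \<in> ?P - {id}"
      have "(\<Prod>j\<in>UNIV - {i}. F 0 $ j $ p j) = 0" for i
      proof -
        obtain k where k: "p k \<noteq> k" using p by (auto simp: fun_eq_iff)
        \<comment> \<open>a permutation other than the identity moves at least two indices\<close>
        have "\<exists>j. j \<noteq> i \<and> p j \<noteq> j"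
        proof (cases "k = i")
          case True
          have "inj p" using p by (auto intro: permutes_inj)
          then have "p (p k) \<noteq> p k" using k by (simp add: inj_eq)
          with True k show ?thesis by (intro exI[of _ "p k"]) simp
        qed (use k in auto)
        then obtain j where "j \<noteq> i" "p j \<noteq> j" by blast
        then show ?thesis by (intro prod_zero bexI[of _ j]) (auto simp: F0 mat_def)
      qed
      then show "?d p = 0" by (simp only: mult_zero_right sum.neutral_const)
    qed
  qed
  moreover have "(\<Sum>p\<in>{id}. ?d p) = mtrace D"
    by (simp add: F0 mtrace_def mat_def sign_id)
  ultimately show ?thesis by simp
qed

text \<open>The group law moves the derivative at 0 to every t, which gives the scalar equation f' =
  f tr A. Division by the expected solution leaves a constant.\<close>

lemma det_mexp: "det (mexp t A) = exp (t * mtrace A)" for A :: "real^'n^'n"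
proof -
  have d0: "((\<lambda>t. det (mexp t A)) has_real_derivative mtrace A) (at 0)"
  proof (rule det_has_real_derivative_at_identity)
    fix i j
    have "bounded_linear (\<lambda>M::real^'n^'n. M $ i $ j)"
      by (intro bounded_linear_compose[OF bounded_linear_vec_nth bounded_linear_vec_nth])
    from bounded_linear.has_vector_derivative[OF this mexp_has_vector_derivative[of A 0]]
    show "((\<lambda>t. mexp t A $ i $ j) has_real_derivative A $ i $ j) (at 0)"
      by (simp add: has_real_derivative_iff_has_vector_derivative)
  qed simp
  have d: "((\<lambda>t. det (mexp t A)) has_real_derivative det (mexp t A) * mtrace A) (at t)" for t
  proof -
    have "((\<lambda>s. det (mexp t A) * det (mexp s A)) has_real_derivative det (mexp t A) * mtrace A) (at 0)"
      by (rule DERIV_cmult[OF d0])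
    then have "((\<lambda>s. det (mexp (s + t) A)) has_real_derivative det (mexp t A) * mtrace A) (at 0)"
      by (simp add: mexp_add det_mul mult.commute)
    then show ?thesis using DERIV_shift[of "\<lambda>t. det (mexp t A)" _ 0 t] by simp
  qed
  have "((\<lambda>t. det (mexp t A) * exp (- (t * mtrace A))) has_real_derivative 0) (at t)" for t
    by (auto intro!: derivative_eq_intros d)
  then have "\<forall>t. det (mexp t A) * exp (- (t * mtrace A)) = det (mexp 0 A) * exp (- (0 * mtrace A))"
    using DERIV_isconst_all[of "\<lambda>t. det (mexp t A) * exp (- (t * mtrace A))"] by blast
  then show ?thesis by (simp add: exp_minus field_simps)
qed

text \<open>The library states the transformation formula for Lebesgue measure only over well-ordered
  index types. A finite index type is therefore replaced by a well-ordered copy of itself.\<close>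

typedef 'a wocopy = "UNIV :: 'a set" morphisms of_wocopy to_wocopy by simp

lemma all_wocopy: "(\<forall>i. Q i) \<longleftrightarrow> (\<forall>i. Q (to_wocopy i))"
  using of_wocopy_inverse by metis

lemma bij_of_wocopy: "bij of_wocopy"
  by (rule o_bij[of to_wocopy]) (auto simp: of_wocopy_inverse to_wocopy_inverse)

instance wocopy :: (finite) finite
proof
  have "finite (range (to_wocopy :: 'a \<Rightarrow> 'a wocopy))" by simp
  moreover have "range to_wocopy = (UNIV :: 'a wocopy set)"
    by (rule surjI[of _ of_wocopy]) (rule of_wocopy_inverse)
  ultimately show "finite (UNIV :: 'a wocopy set)" by simp
qed

definition wocopy_rank :: "'a::finite wocopy \<Rightarrow> nat" where
  "wocopy_rank = (SOME f. inj f)"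

lemma inj_wocopy_rank: "inj (wocopy_rank :: 'a::finite wocopy \<Rightarrow> nat)"
proof -
  obtain f :: "'a wocopy \<Rightarrow> nat" where "inj f"
    using finite_imp_inj_to_nat_seg[of "UNIV :: 'a wocopy set"] by auto
  then show ?thesis unfolding wocopy_rank_def by (rule someI[of inj])
qed

instantiation wocopy :: (finite) wellorder
begin

definition "x \<le> y \<longleftrightarrow> wocopy_rank x \<le> wocopy_rank y"
definition "x < y \<longleftrightarrow> wocopy_rank x < wocopy_rank y"

instance
proof
  fix P :: "'a wocopy \<Rightarrow> bool" and a
  assume step: "\<And>x. (\<And>y. y < x \<Longrightarrow> P y) \<Longrightarrow> P x"
  show "P a"
  proof (induction a rule: measure_induct_rule[of wocopy_rank])
    case (less x)
    show ?case by (rule step, rule less) (simp add: less_wocopy_def)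
  qed
qed (auto simp: less_eq_wocopy_def less_wocopy_def dest: injD[OF inj_wocopy_rank])

end

section \<open>Volume of images under the matrix exponential\<close>

definition reindex_vec :: "real^'n \<Rightarrow> real^('n wocopy)" where
  "reindex_vec x = (\<chi> i. x $ of_wocopy i)"

definition reindex_mat :: "real^'n^'n \<Rightarrow> real^('n wocopy)^('n wocopy)" where
  "reindex_mat A = (\<chi> i j. A $ of_wocopy i $ of_wocopy j)"

lemma sum_of_wocopy: "(\<Sum>i\<in>UNIV. f (of_wocopy i)) = (\<Sum>i\<in>UNIV. f i)"
  using sum.reindex_bij_betw[OF bij_of_wocopy, of f] .

lemma prod_of_wocopy: "(\<Prod>i\<in>UNIV. f (of_wocopy i)) = (\<Prod>i\<in>UNIV. f i)"
  using prod.reindex_bij_betw[OF bij_of_wocopy, of f] .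

lemma reindex_vec_mult: "reindex_vec (A *v x) = reindex_mat A *v reindex_vec x"
  unfolding vec_eq_iff reindex_vec_def reindex_mat_def matrix_vector_mult_def vec_lambda_beta
  by (intro allI sum_of_wocopy[symmetric])

lemma reindex_mat_mult: "reindex_mat (A ** B) = reindex_mat A ** reindex_mat B"
  unfolding vec_eq_iff reindex_mat_def matrix_matrix_mult_def vec_lambda_beta
  by (intro allI sum_of_wocopy[symmetric])

lemma reindex_mat_1: "reindex_mat (mat 1) = mat 1"
  by (simp add: vec_eq_iff reindex_mat_def mat_def of_wocopy_inject)

lemma mtrace_reindex_mat: "mtrace (reindex_mat A) = mtrace A"
  unfolding mtrace_def reindex_mat_def vec_lambda_beta by (rule sum_of_wocopy)

lemma reindex_mat_mexp: "reindex_mat (mexp t A) = mexp t (reindex_mat A)" for A :: "real^'n^'n"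
proof -
  have "linear (reindex_mat :: real^'n^'n \<Rightarrow> _)"
    by (rule linearI) (simp_all add: vec_eq_iff reindex_mat_def)
  then have "bounded_linear (reindex_mat :: real^'n^'n \<Rightarrow> _)"
    by (simp add: linear_conv_bounded_linear)
  from bounded_linear.suminf[OF this summable_mexp[of t A]]
  have "reindex_mat (mexp t A) = (\<Sum>k. reindex_mat ((t ^ k / fact k) *\<^sub>R mpow A k))"
    by (simp add: mexp_def)
  moreover have "reindex_mat (mpow A k) = mpow (reindex_mat A) k" for k
    by (induction k) (simp_all add: mpow_Suc reindex_mat_1 reindex_mat_mult)
  moreover have "reindex_mat (c *\<^sub>R M) = c *\<^sub>R reindex_mat M" for c and M :: "real^'n^'n"
    by (simp add: vec_eq_iff reindex_mat_def)
  ultimately show ?thesis by (simp add: mexp_def)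
qed

lemma inj_reindex_vec: "inj reindex_vec"
proof (rule injI)
  fix x y :: "real^'n" assume "reindex_vec x = reindex_vec y"
  then have *: "x $ of_wocopy i = y $ of_wocopy i" for i
    by (simp add: reindex_vec_def vec_eq_iff)
  have "x $ i = y $ i" for i
    using *[of "to_wocopy i"] by (simp add: to_wocopy_inverse)
  then show "x = y" by (simp add: vec_eq_iff)
qed

lemma prod_Basis_cart: "(\<Prod>b\<in>Basis. x \<bullet> b) = (\<Prod>i\<in>UNIV. x $ i)" for x :: "real^'n"
proof -
  have "(Basis :: (real^'n) set) = range (\<lambda>i. axis i 1)" by (auto simp: Basis_vec_def)
  moreover have "inj (\<lambda>i::'n. axis i (1::real))" by (auto simp: inj_on_def axis_eq_axis)
  ultimately show ?thesis
    using prod.reindex[of "\<lambda>i::'n. axis i (1::real)" UNIV "\<lambda>b. x \<bullet> b"] by (simp add: inner_axis)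
qed

lemma continuous_on_reindex_vec: "continuous_on S (reindex_vec :: real^'n \<Rightarrow> _)"
  unfolding reindex_vec_def by (intro continuous_intros)

text \<open>Lebesgue measure is determined by its values on boxes, and renaming coordinates turns
  boxes into boxes with the same side lengths.\<close>

lemma lborel_distr_reindex_vec: "distr lborel borel (reindex_vec :: real^'n \<Rightarrow> _) = lborel"
proof (rule lborel_eqI[symmetric])
  have [measurable]: "(reindex_vec :: real^'n \<Rightarrow> _) \<in> borel_measurable borel"
    by (intro borel_measurable_continuous_onI continuous_on_reindex_vec)
  fix l u :: "real^('n wocopy)"
  assume le: "\<And>b. b \<in> Basis \<Longrightarrow> l \<bullet> b \<le> u \<bullet> b"
  define l' :: "real^'n" where "l' = (\<chi> i. l $ to_wocopy i)"
  define u' :: "real^'n" where "u' = (\<chi> i. u $ to_wocopy i)"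
  have le': "l $ i \<le> u $ i" for i
    using le[of "axis i 1"] by (simp add: inner_axis axis_in_Basis_iff)
  have pre: "reindex_vec -` box l u = box l' u'"
  proof -
    have "(\<forall>i. l $ i < x $ of_wocopy i \<and> x $ of_wocopy i < u $ i) \<longleftrightarrow>
          (\<forall>i. l $ to_wocopy i < x $ i \<and> x $ i < u $ to_wocopy i)" for x :: "real^'n"
      by (subst all_wocopy) (simp add: to_wocopy_inverse)
    then show ?thesis by (auto simp: box_def mem_box_cart reindex_vec_def l'_def u'_def Basis_vec_def inner_axis)
  qed
  have "emeasure (distr lborel borel reindex_vec) (box l u) = emeasure lborel (box l' u')"
    by (subst emeasure_distr) (simp_all add: pre)
  also have "\<dots> = ennreal (\<Prod>i\<in>UNIV. (u' - l') $ i)"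
    unfolding prod_Basis_cart[symmetric]
    by (rule emeasure_lborel_box) (auto simp: l'_def u'_def Basis_vec_def inner_axis le')
  also have "(\<Prod>i\<in>UNIV. (u' - l') $ i) = (\<Prod>i\<in>UNIV. (u - l) $ i)"
    using prod_of_wocopy[of "\<lambda>i. (u' - l') $ i"] by (simp add: u'_def l'_def of_wocopy_inverse)
  finally show "emeasure (distr lborel borel reindex_vec) (box l u) = (\<Prod>b\<in>Basis. (u - l) \<bullet> b)"
    by (simp only: prod_Basis_cart)
qed simp

lemma measure_reindex_vec_image:
  assumes "compact S"
  shows "measure lebesgue (reindex_vec ` S) = measure lebesgue S"
proof -
  have [measurable]: "(reindex_vec :: real^'a \<Rightarrow> _) \<in> borel_measurable borel"
    by (intro borel_measurable_continuous_onI continuous_on_reindex_vec)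
  have c: "compact (reindex_vec ` S)"
    by (rule compact_continuous_image[OF continuous_on_reindex_vec assms])
  then have "measure lebesgue (reindex_vec ` S) = measure (distr lborel borel reindex_vec) (reindex_vec ` S)"
    by (simp add: measure_completion borel_compact lborel_distr_reindex_vec)
  also have "\<dots> = measure lborel S"
    using c by (subst measure_distr) (auto simp: borel_compact inj_vimage_image_eq[OF inj_reindex_vec])
  finally show ?thesis
    using assms by (simp add: measure_completion borel_compact)
qed

lemma measure_mexp_image:
  fixes A :: "real^'n^'n"
  assumes "compact S"
  shows "measure lebesgue ((*v) (mexp t A) ` S) = exp (t * mtrace A) * measure lebesgue S"
proof -
  let ?T = "mexp t (reindex_mat A)"
  have "compact ((*v) (mexp t A) ` S)"
    by (intro compact_continuous_image assms linear_continuous_on) simp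
  then have "measure lebesgue ((*v) (mexp t A) ` S) = measure lebesgue (reindex_vec ` (*v) (mexp t A) ` S)"
    by (rule measure_reindex_vec_image[symmetric])
  also have "reindex_vec ` (*v) (mexp t A) ` S = (*v) ?T ` reindex_vec ` S"
    by (simp add: image_image reindex_vec_mult reindex_mat_mexp)
  also have "measure lebesgue \<dots> = \<bar>det (matrix ((*v) ?T))\<bar> * measure lebesgue (reindex_vec ` S)"
    by (intro measure_linear_image lmeasurable_compact compact_continuous_image[OF continuous_on_reindex_vec assms])
       simp
  also have "\<dots> = exp (t * mtrace A) * measure lebesgue S"
    by (simp add: det_mexp mtrace_reindex_mat measure_reindex_vec_image assms)
  finally show ?thesis .
qed

lemma mexp_polar:
  fixes A :: "real^'n^'n"
  assumes "min_re_eig A > 0" "y \<noteq> 0"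
  shows "\<exists>t \<theta>. norm \<theta> = 1 \<and> y = mexp t A *v \<theta>"
proof -
  define \<gamma> where "\<gamma> = min_re_eig A / 2"
  have "\<gamma> > 0" "\<gamma> < min_re_eig A" using assms by (auto simp: \<gamma>_def)
  then obtain C where "C > 0" and C: "\<And>t. t \<le> 0 \<Longrightarrow> norm (mexp t A) \<le> C * exp (\<gamma> * t)"
    using mexp_decay by blast
  define h where "h s = norm (mexp (- s) A *v y)" for s
  \<comment> \<open>The logarithms solve C exp(- \<gamma> s1) |y| = 1 and C exp(\<gamma> s2) = |y|.
    The truncations at 0 keep - s1 and s2 in the range where the decay bound holds.\<close>
  define s1 where "s1 = max 0 (ln (C * norm y) / \<gamma>)"
  define s2 where "s2 = min 0 (- ln (C / norm y) / \<gamma>)"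
  have "h s1 \<le> norm (mexp (- s1) A) * norm y"
    unfolding h_def by (rule norm_matrix_vector_le)
  also have "\<dots> \<le> C * exp (\<gamma> * (- s1)) * norm y"
    by (intro mult_right_mono C) (auto simp: s1_def)
  also have "\<dots> \<le> 1"
  proof -
    have "ln (C * norm y) \<le> \<gamma> * s1"
      using \<open>\<gamma> > 0\<close> by (simp add: s1_def field_simps max_def)
    then have "C * norm y \<le> exp (\<gamma> * s1)"
      using \<open>C > 0\<close> \<open>y \<noteq> 0\<close> by (metis exp_le_cancel_iff exp_ln mult_pos_pos zero_less_norm_iff)
    then show ?thesis by (simp add: exp_minus field_simps)
  qed
  finally have h1: "h s1 \<le> 1" .
  \<comment> \<open>A lower bound on h is obtained by undoing the flow: y is the image of the moved
    vector under exp(s2 A), whose norm is small.\<close>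
  have "norm y = norm (mexp s2 A *v (mexp (- s2) A *v y))"
    by (simp add: matrix_vector_mul_assoc)
  also have "\<dots> \<le> norm (mexp s2 A) * h s2"
    unfolding h_def by (rule norm_matrix_vector_le)
  also have "\<dots> \<le> C * exp (\<gamma> * s2) * h s2"
    by (intro mult_right_mono C) (auto simp: s2_def h_def)
  finally have "norm y \<le> C * exp (\<gamma> * s2) * h s2" .
  moreover have "C * exp (\<gamma> * s2) \<le> norm y"
  proof -
    have "\<gamma> * s2 \<le> - ln (C / norm y)"
      using \<open>\<gamma> > 0\<close> by (simp add: s2_def field_simps min_def)
    then have "exp (\<gamma> * s2) \<le> exp (- ln (C / norm y))" by simp
    also have "\<dots> = norm y / C"
      using \<open>C > 0\<close> \<open>y \<noteq> 0\<close> by (simp add: exp_minus)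
    finally show ?thesis using \<open>C > 0\<close> by (simp add: field_simps)
  qed
  then have "C * exp (\<gamma> * s2) * h s2 \<le> norm y * h s2"
    by (rule mult_right_mono) (simp add: h_def)
  ultimately have "norm y \<le> norm y * h s2" by simp
  then have h2: "h s2 \<ge> 1" using \<open>y \<noteq> 0\<close> by simp
  have "\<exists>s. s2 \<le> s \<and> s \<le> s1 \<and> h s = 1"
  proof (rule IVT2')
    show "s2 \<le> s1" by (simp add: s1_def s2_def)
    show "continuous_on {s2..s1} h"
      unfolding h_def
      by (intro continuous_on_norm bounded_bilinear.continuous_on[OF bounded_bilinear_matrix_vector]
          continuous_intros)
  qed (use h1 h2 in auto)
  then obtain s where "h s = 1" by blast
  then show ?thesis
    by (intro exI[of _ s] exI[of _ "mexp (- s) A *v y"]) (simp add: h_def matrix_vector_mul_assoc)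
qed

section \<open>Characteristic functions of simple integrals\<close>

lemma norm_exp_minus_one_le:
  fixes z :: complex
  assumes "norm z \<le> 1/2"
  shows "norm (exp z - 1) \<le> 2 * norm z"
proof -
  have "norm (exp z - exp 0) \<le> 2 * norm (z - 0)"
  proof (rule field_differentiable_bound)
    show "convex (cball (0::complex) (1/2))" by simp
    show "(exp has_field_derivative exp w) (at w within cball 0 (1/2))" for w :: complex
      by (auto intro!: derivative_eq_intros)
    show "norm (exp w) \<le> 2" if "w \<in> cball (0::complex) (1/2)" for w
      using that by (intro exp_bound_half) simp
  qed (use assms in auto)
  then show ?thesis by simp
qed

lemma integral_one_minus_cos:
  fixes x T :: real
  assumes "x \<noteq> 0" "T > 0"
  shows "(\<integral>\<^sup>+t. ennreal (1 - cos (t * x)) * indicator {0..T} t \<partial>lborel) = ennreal (T - sin (T * x) / x)"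
proof -
  have "(\<integral>\<^sup>+t. ennreal (1 - cos (t * x)) * indicator {0..T} t \<partial>lborel)
      = ennreal ((T - sin (T * x) / x) - (0 - sin (0 * x) / x))"
  proof (rule nn_integral_FTC_Icc)
    show "(\<lambda>t. 1 - cos (t * x)) \<in> borel_measurable borel"
      by (intro borel_measurable_continuous_onI continuous_intros)
    show "((\<lambda>t. t - sin (t * x) / x) has_real_derivative 1 - cos (t * x)) (at t)" for t
      using assms by (auto intro!: derivative_eq_intros)
  qed (use assms in auto)
  then show ?thesis by simp
qed

text \<open>Truncation inequality: averaging \<open>1 - cos (t X)\<close> over \<open>t \<in> {0..T}\<close> gives
  \<open>1 - sin (T X) / (T X)\<close>, which is at least \<open>1/2\<close> once \<open>\<bar>X\<bar> \<ge> 2 / T\<close>.\<close>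

lemma (in prob_space) tail_bound_charfun_real:
  fixes X :: "'a \<Rightarrow> real"
  assumes [measurable]: "X \<in> borel_measurable M" and "T > 0" "\<eta> \<ge> 0"
    and ch: "\<And>t. t \<in> {0..T} \<Longrightarrow> norm ((\<integral>\<omega>. exp (\<i> * complex_of_real (t * X \<omega>)) \<partial>M) - 1) \<le> \<eta>"
  shows "prob {\<omega>\<in>space M. \<bar>X \<omega>\<bar> > 2 / T} \<le> 2 * \<eta>"
proof -
  interpret pair_sigma_finite M lborel ..
  let ?B = "{\<omega>\<in>space M. \<bar>X \<omega>\<bar> > 2 / T}"
  let ?f = "\<lambda>\<omega> t. ennreal (1 - cos (t * X \<omega>)) * indicator {0..T} t"
  have inner: "(\<integral>\<^sup>+\<omega>. ennreal (1 - cos (t * X \<omega>)) \<partial>M) \<le> ennreal \<eta>" if "t \<in> {0..T}" for t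
  proof -
    have int: "integrable M (\<lambda>\<omega>. exp (\<i> * complex_of_real (t * X \<omega>)))"
      by (rule integrable_const_bound[of _ 1]) (auto simp: norm_exp_i_times)
    have intc: "integrable M (\<lambda>\<omega>. 1 - cos (t * X \<omega>))"
    proof (rule integrable_const_bound[of _ 2])
      have "norm (1 - cos r) \<le> 2" for r :: real
        using cos_ge_minus_one[of r] cos_le_one[of r] by (simp add: abs_le_iff)
      then show "AE \<omega> in M. norm (1 - cos (t * X \<omega>)) \<le> 2" by simp
    qed measurable
    have "(\<integral>\<omega>. 1 - cos (t * X \<omega>) \<partial>M) = 1 - (\<integral>\<omega>. Re (exp (\<i> * complex_of_real (t * X \<omega>))) \<partial>M)"
    proof -
      have "integrable M (\<lambda>\<omega>. cos (t * X \<omega>))"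
        by (rule integrable_const_bound[of _ 1]) auto
      then show ?thesis by (simp add: prob_space Re_exp)
    qed
    also have "\<dots> = Re (1 - (\<integral>\<omega>. exp (\<i> * complex_of_real (t * X \<omega>)) \<partial>M))"
      using int by simp
    also have "\<dots> \<le> norm (1 - (\<integral>\<omega>. exp (\<i> * complex_of_real (t * X \<omega>)) \<partial>M))"
      by (rule complex_Re_le_cmod)
    also have "\<dots> \<le> \<eta>" using ch[OF that] by (simp add: norm_minus_commute)
    finally have "(\<integral>\<omega>. 1 - cos (t * X \<omega>) \<partial>M) \<le> \<eta>" .
    then show ?thesis
      using intc by (subst nn_integral_eq_integral) (auto simp: ennreal_leI)
  qed
  have "ennreal (T / 2) * emeasure M ?B = (\<integral>\<^sup>+\<omega>. ennreal (T / 2) * indicator ?B \<omega> \<partial>M)"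
    by (subst nn_integral_cmult_indicator) auto
  also have "\<dots> \<le> (\<integral>\<^sup>+\<omega>. \<integral>\<^sup>+t. ?f \<omega> t \<partial>lborel \<partial>M)"
  proof (rule nn_integral_mono)
    fix \<omega> assume "\<omega> \<in> space M"
    show "ennreal (T / 2) * indicator ?B \<omega> \<le> (\<integral>\<^sup>+t. ?f \<omega> t \<partial>lborel)"
    proof (cases "\<omega> \<in> ?B")
      case True
      then have X: "\<bar>X \<omega>\<bar> > 2 / T" by simp
      then have "X \<omega> \<noteq> 0" using \<open>T > 0\<close> by (auto simp: field_simps)
      have "\<bar>sin (T * X \<omega>) / X \<omega>\<bar> \<le> 1 / \<bar>X \<omega>\<bar>"
        by (simp add: abs_divide divide_right_mono)
      also have "\<dots> \<le> T / 2"
        using X \<open>T > 0\<close> \<open>X \<omega> \<noteq> 0\<close> by (simp add: field_simps)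
      finally have "T / 2 \<le> T - sin (T * X \<omega>) / X \<omega>" by linarith
      then show ?thesis
        using True by (simp add: integral_one_minus_cos[OF \<open>X \<omega> \<noteq> 0\<close> \<open>T > 0\<close>] ennreal_leI)
    qed simp
  qed
  also have "\<dots> = (\<integral>\<^sup>+t. \<integral>\<^sup>+\<omega>. ?f \<omega> t \<partial>M \<partial>lborel)"
    by (rule Fubini'[symmetric]) measurable
  also have "\<dots> = (\<integral>\<^sup>+t. (\<integral>\<^sup>+\<omega>. ennreal (1 - cos (t * X \<omega>)) \<partial>M) * indicator {0..T} t \<partial>lborel)"
    by (intro nn_integral_cong nn_integral_multc) measurable
  also have "\<dots> \<le> (\<integral>\<^sup>+t. ennreal \<eta> * indicator {0..T} t \<partial>lborel)"
    by (intro nn_integral_mono) (auto simp: inner split: split_indicator)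
  also have "\<dots> = ennreal (\<eta> * T)"
    using \<open>T > 0\<close> \<open>\<eta> \<ge> 0\<close> by (subst nn_integral_cmult_indicator) (auto simp: ennreal_mult)
  finally have "T / 2 * prob ?B \<le> \<eta> * T"
    using \<open>T > 0\<close> \<open>\<eta> \<ge> 0\<close> by (simp add: emeasure_eq_measure flip: ennreal_mult)
  then show ?thesis using \<open>T > 0\<close> by (simp add: field_simps)
qed

text \<open>The scalar inequality is applied to each coordinate with 2 / T = \<epsilon> / n. If no
  coordinate exceeds this, the sum of their absolute values, and hence the norm, is at most
  \<epsilon>.\<close>

lemma (in prob_space) tail_bound_charfun:
  fixes X :: "'a \<Rightarrow> real^'n"
  assumes [measurable]: "X \<in> borel_measurable M" and "\<epsilon> > 0" "\<eta> \<ge> 0"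
    and ch: "\<And>u. norm u \<le> 2 * real CARD('n) / \<epsilon> \<Longrightarrow> norm (charfun_v (distr M borel X) u - 1) \<le> \<eta>"
  shows "prob {\<omega>\<in>space M. norm (X \<omega>) > \<epsilon>} \<le> 2 * real CARD('n) * \<eta>"
proof -
  define T where "T = 2 * real CARD('n) / \<epsilon>"
  have "T > 0" using \<open>\<epsilon> > 0\<close> by (simp add: T_def)
  have [measurable]: "(\<lambda>\<omega>. X \<omega> $ i) \<in> borel_measurable M" for i
    by (rule measurable_compose[OF assms(1) borel_measurable_continuous_onI])
       (intro continuous_intros)
  have comp: "prob {\<omega>\<in>space M. \<bar>X \<omega> $ i\<bar> > 2 / T} \<le> 2 * \<eta>" for i
  proof (rule tail_bound_charfun_real)
    fix t assume t: "t \<in> {0..T}"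
    have "(\<integral>\<omega>. exp (\<i> * complex_of_real (t * X \<omega> $ i)) \<partial>M) = charfun_v (distr M borel X) (t *\<^sub>R axis i 1)"
      unfolding charfun_v_def by (subst integral_distr) (auto simp: inner_axis' )
    then show "norm ((\<integral>\<omega>. exp (\<i> * complex_of_real (t * X \<omega> $ i)) \<partial>M) - 1) \<le> \<eta>"
      using ch[of "t *\<^sub>R axis i 1"] t by (simp add: T_def)
  qed (use \<open>T > 0\<close> \<open>\<eta> \<ge> 0\<close> in auto)
  have "2 / T = \<epsilon> / real CARD('n)" by (simp add: T_def)
  have "{\<omega>\<in>space M. norm (X \<omega>) > \<epsilon>} \<subseteq> (\<Union>i. {\<omega>\<in>space M. \<bar>X \<omega> $ i\<bar> > 2 / T})"
  proof (rule subsetI, rule ccontr)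
    fix \<omega> assume \<omega>: "\<omega> \<in> {\<omega>\<in>space M. norm (X \<omega>) > \<epsilon>}" "\<omega> \<notin> (\<Union>i. {\<omega>\<in>space M. \<bar>X \<omega> $ i\<bar> > 2 / T})"
    then have "\<bar>X \<omega> $ i\<bar> \<le> \<epsilon> / real CARD('n)" for i
      using \<open>2 / T = _\<close> by (auto simp: not_less)
    then have "(\<Sum>i\<in>UNIV. \<bar>X \<omega> $ i\<bar>) \<le> (\<Sum>i\<in>(UNIV::'n set). \<epsilon> / real CARD('n))"
      by (intro sum_mono)
    then show False using \<omega>(1) norm_le_l1_cart[of "X \<omega>"] by simp
  qed
  then have "prob {\<omega>\<in>space M. norm (X \<omega>) > \<epsilon>} \<le> prob (\<Union>i. {\<omega>\<in>space M. \<bar>X \<omega> $ i\<bar> > 2 / T})"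
    by (intro finite_measure_mono) auto
  also have "\<dots> \<le> (\<Sum>i\<in>UNIV. prob {\<omega>\<in>space M. \<bar>X \<omega> $ i\<bar> > 2 / T})"
    by (intro finite_measure_subadditive_finite) auto
  also have "\<dots> \<le> (\<Sum>i\<in>(UNIV::'n set). 2 * \<eta>)"
    by (intro sum_mono comp)
  finally show ?thesis by (simp add: mult_ac)
qed

section \<open>Finite additivity of the random measure and laws of weighted sums\<close>

lemma adm_empty: "adm {}"
  by (simp add: adm_def)

lemma adm_subset: "adm A \<Longrightarrow> B \<in> sets lborel \<Longrightarrow> B \<subseteq> A \<Longrightarrow> adm B"
  unfolding adm_def using emeasure_mono[of B A lborel] by (auto intro: le_less_trans)

lemma adm_Un: "adm A \<Longrightarrow> adm B \<Longrightarrow> adm (A \<union> B)"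
  unfolding adm_def using emeasure_subadditive[of A lborel B]
  by (auto intro!: le_less_trans[OF emeasure_subadditive])

lemma adm_UN: "finite I \<Longrightarrow> (\<And>i. i \<in> I \<Longrightarrow> adm (C i)) \<Longrightarrow> adm (\<Union>i\<in>I. C i)"
  by (induction I rule: finite_induct) (simp_all add: adm_empty adm_Un)

context
  fixes P :: "'w measure" and Mr :: "(real^'d) set \<Rightarrow> 'w \<Rightarrow> real^'n" and \<psi> :: "real^'n \<Rightarrow> complex"
  assumes rm: "indep_scattered_rm P Mr \<psi>"
begin

interpretation prob_space P
  using rm by (simp add: indep_scattered_rm_def)

lemma rm_measurable: "adm A \<Longrightarrow> Mr A \<in> borel_measurable P"
  using rm by (simp add: indep_scattered_rm_def)

lemma rm_charfun: "adm A \<Longrightarrow> charfun_v (distr P borel (Mr A)) u = exp (complex_of_real (measure lborel A) * \<psi> u)"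
  using rm by (simp add: indep_scattered_rm_def)

lemma rm_sums:
  fixes A :: "nat \<Rightarrow> (real^'d) set"
  assumes "\<And>k. adm (A k)" "disjoint_family A" "adm (\<Union>k. A k)"
  shows "AE \<omega> in P. (\<lambda>k. Mr (A k) \<omega>) sums Mr (\<Union>k. A k) \<omega>"
  using rm assms by (auto simp: indep_scattered_rm_def)

text \<open>Additivity along the constant sequence of empty sets makes a constant series converge,
  which is possible only with terms 0.\<close>

lemma rm_empty: "AE \<omega> in P. Mr {} \<omega> = 0"
proof -
  have "AE \<omega> in P. (\<lambda>k::nat. Mr {} \<omega>) sums Mr (\<Union>k::nat. {}) \<omega>"
    by (rule rm_sums) (auto simp: adm_empty disjoint_family_on_def)
  then show ?thesis
    by eventually_elim (auto simp: sums_iff summable_const_iff)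
qed

text \<open>The random measure is given as countably additive, so two sets are padded with empty
  ones, whose values vanish almost surely.\<close>

lemma rm_Un:
  assumes "adm A" "adm B" "A \<inter> B = {}"
  shows "AE \<omega> in P. Mr (A \<union> B) \<omega> = Mr A \<omega> + Mr B \<omega>"
proof -
  define C where "C k = (if k = 0 then A else if k = 1 then B else {})" for k :: nat
  have U: "(\<Union>k. C k) = A \<union> B"
    by (auto simp: C_def split: if_splits)
  have "AE \<omega> in P. (\<lambda>k. Mr (C k) \<omega>) sums Mr (\<Union>k. C k) \<omega>"
  proof (rule rm_sums)
    show "disjoint_family C" using assms(3) by (auto simp: disjoint_family_on_def C_def)
  qed (use assms in \<open>auto simp: U adm_Un, auto simp: C_def adm_empty\<close>)
  with rm_empty show ?thesis
  proof eventually_elim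
    case (elim \<omega>)
    have "(\<lambda>k. Mr (C k) \<omega>) sums (\<Sum>k\<in>{0,1}. Mr (C k) \<omega>)"
      by (rule sums_finite) (auto simp: C_def elim)
    then have "Mr (\<Union>k. C k) \<omega> = (\<Sum>k\<in>{0,1}. Mr (C k) \<omega>)"
      using elim(2) by (rule sums_unique2[symmetric])
    then show ?case unfolding U by (simp add: C_def)
  qed
qed

lemma rm_UN:
  assumes "finite I" "\<And>i. i \<in> I \<Longrightarrow> adm (C i)" "disjoint_family_on C I"
  shows "AE \<omega> in P. Mr (\<Union>i\<in>I. C i) \<omega> = (\<Sum>i\<in>I. Mr (C i) \<omega>)"
  using assms
proof (induction I rule: finite_induct)
  case empty
  then show ?case using rm_empty by simp
next
  case (insert i I)
  have "AE \<omega> in P. Mr (C i \<union> (\<Union>i\<in>I. C i)) \<omega> = Mr (C i) \<omega> + Mr (\<Union>i\<in>I. C i) \<omega>"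
    using insert by (intro rm_Un adm_UN) (auto simp: disjoint_family_on_def)
  moreover have "AE \<omega> in P. Mr (\<Union>i\<in>I. C i) \<omega> = (\<Sum>i\<in>I. Mr (C i) \<omega>)"
    using insert by (intro insert.IH) (auto simp: disjoint_family_on_def)
  ultimately show ?case
    by eventually_elim (use insert in auto)
qed

text \<open>Independence factors the expectation. Moving the coefficient across the inner product is
  what introduces the transpose.\<close>

lemma charfun_sum_sets:
  fixes V :: "(real^'d) set \<Rightarrow> real^'n^'n"
  assumes "finite F" "\<And>S. S \<in> F \<Longrightarrow> adm S" "disjoint F"
  shows "charfun_v (distr P borel (\<lambda>\<omega>. \<Sum>S\<in>F. V S *v Mr S \<omega>)) u
       = (\<Prod>S\<in>F. exp (complex_of_real (measure lborel S) * \<psi> (transpose (V S) *v u)))"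
proof -
  have [measurable]: "S \<in> F \<Longrightarrow> Mr S \<in> borel_measurable P" for S
    using assms(2) rm_measurable by blast
  have mv [measurable]: "(\<lambda>x. A *v x) \<in> borel_measurable borel" for A :: "real^'n^'n"
    by (intro borel_measurable_continuous_onI linear_continuous_on) simp
  define X where "X S \<omega> = exp (\<i> * complex_of_real ((transpose (V S) *v u) \<bullet> Mr S \<omega>))" for S \<omega>
  have indep: "indep_vars (\<lambda>_. borel) Mr F"
    using rm assms unfolding indep_scattered_rm_def by blast
  have indepX: "indep_vars (\<lambda>_. borel) X F"
    unfolding X_def by (rule indep_vars_compose2[OF indep]) measurable
  have intX: "integrable P (X S)" if "S \<in> F" for S
    unfolding X_def using that by (intro integrable_const_bound[of _ 1]) (auto simp: norm_exp_i_times)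
  have "charfun_v (distr P borel (\<lambda>\<omega>. \<Sum>S\<in>F. V S *v Mr S \<omega>)) u
      = (\<integral>\<omega>. exp (\<i> * complex_of_real (u \<bullet> (\<Sum>S\<in>F. V S *v Mr S \<omega>))) \<partial>P)"
    unfolding charfun_v_def by (subst integral_distr) auto
  also have "\<dots> = (\<integral>\<omega>. (\<Prod>S\<in>F. X S \<omega>) \<partial>P)"
    using assms(1)
    by (simp add: X_def inner_sum_right sum_distrib_left exp_sum transpose_matrix_vector dot_lmul_matrix)
  also have "\<dots> = (\<Prod>S\<in>F. \<integral>\<omega>. X S \<omega> \<partial>P)"
    by (rule indep_vars_lebesgue_integral[OF assms(1) indepX intX])
  also have "\<dots> = (\<Prod>S\<in>F. charfun_v (distr P borel (Mr S)) (transpose (V S) *v u))"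
    unfolding charfun_v_def X_def by (intro prod.cong refl, subst integral_distr) auto
  also have "\<dots> = (\<Prod>S\<in>F. exp (complex_of_real (measure lborel S) * \<psi> (transpose (V S) *v u)))"
    using assms(2) by (intro prod.cong refl rm_charfun)
  finally show ?thesis .
qed

lemma charfun_sum_family:
  fixes V :: "'i \<Rightarrow> real^'n^'n"
  assumes I: "finite I" "\<And>i. i \<in> I \<Longrightarrow> adm (C i)" "disjoint_family_on C I"
  shows "charfun_v (distr P borel (\<lambda>\<omega>. \<Sum>i\<in>I. V i *v Mr (C i) \<omega>)) u
       = exp (\<Sum>i\<in>I. complex_of_real (measure lborel (C i)) * \<psi> (transpose (V i) *v u))"
proof -
  \<comment> \<open>independence is indexed by the sets themselves, so repeated (necessarily empty) sets are dropped\<close>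
  define J where "J = {i\<in>I. C i \<noteq> {}}"
  have J: "finite J" "J \<subseteq> I" using I by (auto simp: J_def)
  have inj: "inj_on C J"
    using I(3) by (fastforce simp: inj_on_def J_def disjoint_family_on_def)
  define W where "W = V \<circ> the_inv_into J C"
  have W: "W (C i) = V i" if "i \<in> J" for i
    using that inj by (simp add: W_def the_inv_into_f_f)
  have [measurable]: "i \<in> I \<Longrightarrow> Mr (C i) \<in> borel_measurable P" for i
    using I rm_measurable by blast
  have mv [measurable]: "(\<lambda>x. A *v x) \<in> borel_measurable borel" for A :: "real^'n^'n"
    by (intro borel_measurable_continuous_onI linear_continuous_on) simp
  have ae: "AE \<omega> in P. (\<Sum>i\<in>I. V i *v Mr (C i) \<omega>) = (\<Sum>S\<in>C ` J. W S *v Mr S \<omega>)"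
    using rm_empty
  proof eventually_elim
    case (elim \<omega>)
    have "(\<Sum>i\<in>I. V i *v Mr (C i) \<omega>) = (\<Sum>i\<in>J. V i *v Mr (C i) \<omega>)"
      using I J by (intro sum.mono_neutral_right) (auto simp: J_def elim)
    also have "\<dots> = (\<Sum>S\<in>C ` J. W S *v Mr S \<omega>)"
      by (subst sum.reindex[OF inj]) (auto simp: W)
    finally show ?case .
  qed
  have "charfun_v (distr P borel (\<lambda>\<omega>. \<Sum>i\<in>I. V i *v Mr (C i) \<omega>)) u
      = charfun_v (distr P borel (\<lambda>\<omega>. \<Sum>S\<in>C ` J. W S *v Mr S \<omega>)) u"
  proof (subst distr_cong_AE[OF refl refl ae])
    have "Mr S \<in> borel_measurable P" if "S \<in> C ` J" for S
      using that I J rm_measurable by blast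
    then show "(\<lambda>\<omega>. \<Sum>S\<in>C ` J. W S *v Mr S \<omega>) \<in> borel_measurable P" by measurable
  qed auto
  also have "\<dots> = (\<Prod>S\<in>C ` J. exp (complex_of_real (measure lborel S) * \<psi> (transpose (W S) *v u)))"
  proof (rule charfun_sum_sets)
    show "disjoint (C ` J)"
      using I(3) J by (intro disjoint_family_on_disjoint_image) (auto simp: disjoint_family_on_def)
  qed (use I J in auto)
  also have "\<dots> = (\<Prod>i\<in>J. exp (complex_of_real (measure lborel (C i)) * \<psi> (transpose (V i) *v u)))"
    by (subst prod.reindex[OF inj]) (auto simp: W)
  also have "\<dots> = exp (\<Sum>i\<in>J. complex_of_real (measure lborel (C i)) * \<psi> (transpose (V i) *v u))"
    using J by (simp add: exp_sum)
  also have "(\<Sum>i\<in>J. complex_of_real (measure lborel (C i)) * \<psi> (transpose (V i) *v u))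
      = (\<Sum>i\<in>I. complex_of_real (measure lborel (C i)) * \<psi> (transpose (V i) *v u))"
    using I J by (intro sum.mono_neutral_left) (auto simp: J_def)
  finally show ?thesis .
qed

end

section \<open>Two-power bounds and simple integrals indexed by values\<close>

definition powr_sum :: "real \<Rightarrow> real \<Rightarrow> real \<Rightarrow> real" where
  "powr_sum a b r = r powr a + r powr b"

lemma powr_sum_0 [simp]: "powr_sum a b 0 = 0"
  by (simp add: powr_sum_def)

lemma powr_sum_nonneg [simp]: "powr_sum a b r \<ge> 0"
  by (simp add: powr_sum_def)

lemma powr_sum_mono: "a > 0 \<Longrightarrow> b > 0 \<Longrightarrow> 0 \<le> r \<Longrightarrow> r \<le> s \<Longrightarrow> powr_sum a b r \<le> powr_sum a b s"
  by (simp add: powr_sum_def add_mono powr_mono2)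

text \<open>The product on the right has two extra nonnegative cross terms. The inequality separates
  the frequency u from the size of the kernel.\<close>

lemma powr_sum_mult_le: "0 \<le> r \<Longrightarrow> 0 \<le> s \<Longrightarrow> powr_sum a b (r * s) \<le> powr_sum a b r * powr_sum a b s"
  by (simp add: powr_sum_def powr_mult distrib_left distrib_right)

text \<open>The sum r + s is at most twice the larger term. No convexity is involved, so exponents
  below and above 1 are treated alike.\<close>

lemma powr_sum_add_le:
  assumes "a > 0" "b > 0" "0 \<le> r" "0 \<le> s"
  shows "powr_sum a b (r + s) \<le> powr_sum a b (2 * r) + powr_sum a b (2 * s)"
proof (cases "r \<le> s")
  case True
  then have "powr_sum a b (r + s) \<le> powr_sum a b (2 * s)" using assms by (intro powr_sum_mono) auto
  then show ?thesis using powr_sum_nonneg[of a b "2 * r"] by linarith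
next
  case False
  then have "powr_sum a b (r + s) \<le> powr_sum a b (2 * r)" using assms by (intro powr_sum_mono) auto
  then show ?thesis using powr_sum_nonneg[of a b "2 * s"] by linarith
qed

lemma continuous_on_powr_sum [continuous_intros]:
  assumes "a > 0" "b > 0" "continuous_on S f" "\<And>x. x \<in> S \<Longrightarrow> f x \<ge> 0"
  shows "continuous_on S (\<lambda>x. powr_sum a b (f x))"
  unfolding powr_sum_def using assms
  by (intro continuous_on_add continuous_on_powr' continuous_on_const) auto

lemma borel_measurable_powr_sum [measurable]:
  assumes [measurable]: "f \<in> borel_measurable M"
  shows "(\<lambda>x. powr_sum a b (f x)) \<in> borel_measurable M"
  unfolding powr_sum_def by measurable

text \<open>A simple function is presented by its level sets instead of a list, which makes common
  refinements canonical. The zero level may have infinite measure.\<close>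

definition level_simple :: "(real^'d \<Rightarrow> real^'n^'n) \<Rightarrow> bool" where
  "level_simple G \<longleftrightarrow> simple_function lborel G \<and> (\<forall>v. v \<noteq> 0 \<longrightarrow> adm (G -` {v}))"

definition level_int ::
  "((real^'d) set \<Rightarrow> 'w \<Rightarrow> real^'n) \<Rightarrow> (real^'d \<Rightarrow> real^'n^'n) \<Rightarrow> (real^'d) set \<Rightarrow> 'w \<Rightarrow> real^'n" where
  "level_int Mr G A \<omega> = (\<Sum>v\<in>range G - {0}. v *v Mr (A \<inter> G -` {v}) \<omega>)"

lemma level_simple_finite: "level_simple G \<Longrightarrow> finite (range G)"
  by (simp add: level_simple_def simple_function_def)

lemma level_simple_sets: "level_simple G \<Longrightarrow> G -` {v} \<in> sets lborel"
  using simple_functionD(2)[of lborel G "{v}"] by (simp add: level_simple_def)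

lemma level_simple_adm:
  assumes "level_simple G" "v \<noteq> 0" "A \<in> sets lborel"
  shows "adm (A \<inter> G -` {v})"
  using assms level_simple_sets[OF assms(1), of v]
  by (rule_tac adm_subset[of "G -` {v}"]) (auto simp: level_simple_def)

text \<open>At least one of the two values is nonzero, so its level has finite measure; for the
  other level measurability is enough.\<close>

lemma level_simple_adm_Int:
  assumes G: "level_simple G" and H: "level_simple H" and p: "p \<noteq> (0, 0)"
  shows "adm (G -` {fst p} \<inter> H -` {snd p})"
proof (cases "fst p = 0")
  case False
  then show ?thesis
    using level_simple_sets[OF H] level_simple_adm[OF G False, of "H -` {snd p}"] by (simp add: Int_commute)
next
  case True
  then have "snd p \<noteq> 0" using p by (cases p) auto
  then show ?thesis
    using level_simple_sets[OF G] level_simple_adm[OF H, of "snd p" "G -` {fst p}"] by simp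
qed

lemma level_simple_list:
  fixes G :: "real^'d \<Rightarrow> real^'n^'n"
  assumes G: "level_simple G"
  shows "\<exists>S. simple_valid S \<and> simple_fun S = G \<and> (\<forall>(Mr :: (real^'d) set \<Rightarrow> 'w \<Rightarrow> real^'n) A. simple_int Mr S A = level_int Mr G A)"
proof -
  obtain vs where vs: "set vs = range G - {0}" "distinct vs"
    using finite_distinct_list[of "range G - {0}"] level_simple_finite[OF G] by auto
  define S where "S = map (\<lambda>v. (G -` {v}, v)) vs"
  have "simple_valid S"
    unfolding simple_valid_def
  proof
    show "\<forall>p\<in>set S. adm (fst p)" using G vs by (auto simp: S_def level_simple_def)
    show "disjoint_family_on (\<lambda>i. fst (S ! i)) {..<length S}"
      using vs(2) by (auto simp: S_def disjoint_family_on_def nth_eq_iff_index_eq)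
  qed
  moreover have "simple_fun S x = G x" for x
  proof -
    have "simple_fun S x = (\<Sum>v\<leftarrow>vs. indicator (G -` {v}) x *\<^sub>R v)"
      by (simp add: simple_fun_def S_def o_def)
    also have "\<dots> = (\<Sum>v\<in>range G - {0}. indicator (G -` {v}) x *\<^sub>R v)"
      using vs by (simp add: sum_list_distinct_conv_sum_set)
    also have "\<dots> = (\<Sum>v\<in>range G - {0}. if v = G x then v else 0)"
      by (intro sum.cong) (auto simp: indicator_def)
    also have "\<dots> = G x"
      using level_simple_finite[OF G] by auto
    finally show ?thesis .
  qed
  moreover have "simple_int Mr S A = level_int Mr G A" for Mr :: "(real^'d) set \<Rightarrow> 'w \<Rightarrow> real^'n" and A
    using vs by (auto simp: simple_int_def level_int_def S_def o_def sum_list_distinct_conv_sum_set)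
  ultimately show ?thesis by auto
qed

lemma AE_sum_cong:
  assumes "finite I" "\<And>i. i \<in> I \<Longrightarrow> AE \<omega> in M. f i \<omega> = g i \<omega>"
  shows "AE \<omega> in M. (\<Sum>i\<in>I. f i \<omega>) = (\<Sum>i\<in>I. g i \<omega>)"
proof -
  have "AE \<omega> in M. \<forall>i\<in>I. f i \<omega> = g i \<omega>"
    using assms by (simp add: AE_finite_all)
  then show ?thesis by eventually_elim (auto intro: sum.cong)
qed

lemma matrix_vector_mult_sum_left:
  "(\<Sum>i\<in>I. c *v x i) = c *v (\<Sum>i\<in>I. x i)" for c :: "real^'n^'m"
  by (induction I rule: infinite_finite_induct) (simp_all add: matrix_vector_right_distrib)

context
  fixes P :: "'w measure" and Mr :: "(real^'d) set \<Rightarrow> 'w \<Rightarrow> real^'n" and \<psi> :: "real^'n \<Rightarrow> complex"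
  assumes rm: "indep_scattered_rm P Mr \<psi>"
begin

interpretation prob_space P
  using rm by (simp add: indep_scattered_rm_def)

lemma level_int_measurable:
  assumes G: "level_simple G" and A: "A \<in> sets lborel"
  shows "level_int Mr G A \<in> borel_measurable P"
proof -
  have mv [measurable]: "(\<lambda>x. v *v x) \<in> borel_measurable borel" for v :: "real^'n^'n"
    by (intro borel_measurable_continuous_onI linear_continuous_on) simp
  have "Mr (A \<inter> G -` {v}) \<in> borel_measurable P" if "v \<in> range G - {0}" for v
    using that by (intro rm_measurable[OF rm] level_simple_adm G A) auto
  then show ?thesis unfolding level_int_def[abs_def] by measurable
qed

text \<open>Pairs with first component 0 contribute nothing, yet they are included so that the index
  set is symmetric in G and H. Only (0,0) is left out, since its cell may have infinite
  measure.\<close>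

lemma level_int_refine:
  fixes G H :: "real^'d \<Rightarrow> real^'n^'n"
  assumes G: "level_simple G" and H: "level_simple H" and A: "A \<in> sets lborel"
  shows "AE \<omega> in P. level_int Mr G A \<omega> =
    (\<Sum>p\<in>range G \<times> range H - {(0,0)}. fst p *v Mr (A \<inter> G -` {fst p} \<inter> H -` {snd p}) \<omega>)"
proof -
  note fin = level_simple_finite[OF G] level_simple_finite[OF H]
  have "AE \<omega> in P. v *v Mr (A \<inter> G -` {v}) \<omega> = (\<Sum>w\<in>range H. v *v Mr (A \<inter> G -` {v} \<inter> H -` {w}) \<omega>)"
    if "v \<in> range G - {0}" for v
  proof -
    have "A \<inter> G -` {v} = (\<Union>w\<in>range H. A \<inter> G -` {v} \<inter> H -` {w})" by auto
    moreover have "AE \<omega> in P. Mr (\<Union>w\<in>range H. A \<inter> G -` {v} \<inter> H -` {w}) \<omega>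
        = (\<Sum>w\<in>range H. Mr (A \<inter> G -` {v} \<inter> H -` {w}) \<omega>)"
    proof (rule rm_UN[OF rm fin(2)])
      show "adm (A \<inter> G -` {v} \<inter> H -` {w})" for w
        using that level_simple_sets[OF G] level_simple_sets[OF H] A
        by (rule_tac adm_subset[OF level_simple_adm[OF G _ A, of v]]) auto
      show "disjoint_family_on (\<lambda>w. A \<inter> G -` {v} \<inter> H -` {w}) (range H)"
        by (auto simp: disjoint_family_on_def)
    qed
    ultimately show ?thesis
      by (auto simp: matrix_vector_mult_sum_left elim!: eventually_mono)
  qed
  then have "AE \<omega> in P. level_int Mr G A \<omega> =
      (\<Sum>v\<in>range G - {0}. \<Sum>w\<in>range H. v *v Mr (A \<inter> G -` {v} \<inter> H -` {w}) \<omega>)"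
    unfolding level_int_def using fin by (intro AE_sum_cong) auto
  moreover have "(\<Sum>v\<in>range G - {0}. \<Sum>w\<in>range H. v *v Mr (A \<inter> G -` {v} \<inter> H -` {w}) \<omega>) =
    (\<Sum>p\<in>range G \<times> range H - {(0,0)}. fst p *v Mr (A \<inter> G -` {fst p} \<inter> H -` {snd p}) \<omega>)" for \<omega>
  proof -
    have "(\<Sum>v\<in>range G - {0}. \<Sum>w\<in>range H. v *v Mr (A \<inter> G -` {v} \<inter> H -` {w}) \<omega>) =
      (\<Sum>p\<in>(range G - {0}) \<times> range H. fst p *v Mr (A \<inter> G -` {fst p} \<inter> H -` {snd p}) \<omega>)"
      by (simp add: sum.cartesian_product case_prod_beta)
    also have "\<dots> = (\<Sum>p\<in>range G \<times> range H - {(0,0)}. fst p *v Mr (A \<inter> G -` {fst p} \<inter> H -` {snd p}) \<omega>)"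
      using fin by (intro sum.mono_neutral_left) auto
    finally show ?thesis .
  qed
  ultimately show ?thesis by simp
qed

lemma level_int_diff:
  fixes G H :: "real^'d \<Rightarrow> real^'n^'n"
  assumes G: "level_simple G" and H: "level_simple H" and A: "A \<in> sets lborel"
  shows "AE \<omega> in P. level_int Mr G A \<omega> - level_int Mr H A \<omega> =
    (\<Sum>p\<in>range G \<times> range H - {(0,0)}. (fst p - snd p) *v Mr (A \<inter> (G -` {fst p} \<inter> H -` {snd p})) \<omega>)"
proof -
  have swap: "(\<Sum>p\<in>range H \<times> range G - {(0,0)}. fst p *v Mr (A \<inter> H -` {fst p} \<inter> G -` {snd p}) \<omega>) =
     (\<Sum>p\<in>range G \<times> range H - {(0,0)}. snd p *v Mr (A \<inter> G -` {fst p} \<inter> H -` {snd p}) \<omega>)" for \<omega>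
    by (rule sum.reindex_bij_witness[where i=prod.swap and j=prod.swap]) (auto simp: Int_ac)
  from level_int_refine[OF G H A] level_int_refine[OF H G A] show ?thesis
    by eventually_elim (simp add: swap[unfolded Int_assoc] matrix_vector_mult_diff_rdistrib sum_subtractf Int_assoc)
qed

text \<open>The partition that carries the difference of the simple integrals also computes this
  integral; the cell (0,0) drops out because \<open>powr_sum\<close> vanishes at 0.\<close>

lemma integral_powr_sum_level:
  fixes G H :: "real^'d \<Rightarrow> real^'n^'n"
  assumes G: "level_simple G" and H: "level_simple H"
  shows "(\<integral>y. powr_sum a b (norm (G y - H y)) \<partial>lborel) =
    (\<Sum>p\<in>range G \<times> range H - {(0,0)}. measure lborel (G -` {fst p} \<inter> H -` {snd p}) * powr_sum a b (norm (fst p - snd p)))"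
proof -
  note fin = level_simple_finite[OF G] level_simple_finite[OF H]
  let ?C = "\<lambda>p. G -` {fst p} \<inter> H -` {snd p}"
  let ?I = "range G \<times> range H - {(0,0)}"
  have adm: "adm (?C p)" if "p \<in> ?I" for p
    using that by (intro level_simple_adm_Int[OF G H]) auto
  have "powr_sum a b (norm (G y - H y)) = (\<Sum>p\<in>?I. indicator (?C p) y * powr_sum a b (norm (fst p - snd p)))" for y
  proof -
    have "(\<Sum>p\<in>?I. indicator (?C p) y * powr_sum a b (norm (fst p - snd p)))
        = (\<Sum>p\<in>?I. if p = (G y, H y) then powr_sum a b (norm (G y - H y)) else 0)"
      by (intro sum.cong) (auto simp: indicator_def)
    also have "\<dots> = powr_sum a b (norm (G y - H y))"
      using fin by auto
    finally show ?thesis by simp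
  qed
  then have "(\<integral>y. powr_sum a b (norm (G y - H y)) \<partial>lborel) =
      (\<integral>y. (\<Sum>p\<in>?I. indicator (?C p) y * powr_sum a b (norm (fst p - snd p))) \<partial>lborel)"
    by simp
  also have "\<dots> = (\<Sum>p\<in>?I. \<integral>y. indicator (?C p) y * powr_sum a b (norm (fst p - snd p)) \<partial>lborel)"
    using adm by (intro Bochner_Integration.integral_sum integrable_mult_left) (auto simp: adm_def)
  finally show ?thesis by simp
qed

text \<open>The log-characteristic function of the difference is a sum over cells, bounded by J for
  all frequencies up to R. Intersecting with A only shrinks the cells, so J does not depend on A.
  The factor 4 is 2 from the truncation inequality times 2 from |exp z - 1| \<le> 2 |z|, which is
  where \<open>J \<le> 1/2\<close> enters.\<close>

lemma level_int_tail:
  fixes G H :: "real^'d \<Rightarrow> real^'n^'n"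
  assumes \<psi>: "\<And>u. norm (\<psi> u) \<le> K * powr_sum a b (norm u)" and "K \<ge> 0" "a > 0" "b > 0"
    and G: "level_simple G" and H: "level_simple H" and A: "A \<in> sets lborel"
    and "\<epsilon> > 0"
    and R: "R = 2 * real CARD('n) / \<epsilon>"
    and J: "J = K * powr_sum a b R * (\<integral>y. powr_sum a b (norm (G y - H y)) \<partial>lborel)"
    and small: "J \<le> 1/2"
  shows "measure P {\<omega>\<in>space P. norm (level_int Mr G A \<omega> - level_int Mr H A \<omega>) > \<epsilon>} \<le> 4 * real CARD('n) * J"
proof -
  note fin = level_simple_finite[OF G] level_simple_finite[OF H]
  let ?C = "\<lambda>p. G -` {fst p} \<inter> H -` {snd p}"
  let ?I = "range G \<times> range H - {(0,0)}"
  let ?D = "\<lambda>\<omega>. \<Sum>p\<in>?I. (fst p - snd p) *v Mr (A \<inter> ?C p) \<omega>"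
  have admC: "adm (?C p)" if "p \<in> ?I" for p
    using that by (intro level_simple_adm_Int[OF G H]) auto
  have admAC: "adm (A \<inter> ?C p)" if "p \<in> ?I" for p
    using A level_simple_sets[OF G] level_simple_sets[OF H] by (rule_tac adm_subset[OF admC[OF that]]) auto
  have Jnn: "J \<ge> 0" unfolding J using \<open>K \<ge> 0\<close> by (intro mult_nonneg_nonneg) auto
  have ch: "norm (charfun_v (distr P borel (\<lambda>\<omega>. level_int Mr G A \<omega> - level_int Mr H A \<omega>)) u - 1) \<le> 2 * J"
    if u: "norm u \<le> R" for u
  proof -
    let ?z = "\<Sum>p\<in>?I. complex_of_real (measure lborel (A \<inter> ?C p)) * \<psi> (transpose (fst p - snd p) *v u)"
    have mv [measurable]: "(\<lambda>x. v *v x) \<in> borel_measurable borel" for v :: "real^'n^'n"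
      by (intro borel_measurable_continuous_onI linear_continuous_on) simp
    have d: "distr P borel (\<lambda>\<omega>. level_int Mr G A \<omega> - level_int Mr H A \<omega>) = distr P borel ?D"
    proof (rule distr_cong_AE[OF refl refl level_int_diff[OF G H A]])
      have "Mr (A \<inter> ?C p) \<in> borel_measurable P" if "p \<in> ?I" for p
        by (rule rm_measurable[OF rm admAC[OF that]])
      then show "?D \<in> borel_measurable P" by measurable
    qed (intro borel_measurable_diff level_int_measurable G H A)
    have c: "charfun_v (distr P borel ?D) u = exp ?z"
    proof (rule charfun_sum_family[OF rm])
      show "disjoint_family_on (\<lambda>p. A \<inter> ?C p) ?I"
        by (auto simp: disjoint_family_on_def)
      show "finite ?I" using fin by simp
    qed (rule admAC)
    have eq: "charfun_v (distr P borel (\<lambda>\<omega>. level_int Mr G A \<omega> - level_int Mr H A \<omega>)) u = exp ?z"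
      unfolding d c ..
    have "norm ?z \<le> (\<Sum>p\<in>?I. measure lborel (?C p) * (K * (powr_sum a b R * powr_sum a b (norm (fst p - snd p)))))"
    proof (rule sum_norm_le)
      fix p assume p: "p \<in> ?I"
      have "norm (transpose (fst p - snd p) *v u) \<le> norm (fst p - snd p) * norm u"
        using norm_matrix_vector_le[of "transpose (fst p - snd p)" u] by (simp add: norm_transpose_matrix)
      also have "\<dots> \<le> R * norm (fst p - snd p)"
        using u by (subst mult.commute) (intro mult_right_mono, auto)
      finally have "powr_sum a b (norm (transpose (fst p - snd p) *v u)) \<le> powr_sum a b (R * norm (fst p - snd p))"
        using \<open>a > 0\<close> \<open>b > 0\<close> by (intro powr_sum_mono) auto
      also have "\<dots> \<le> powr_sum a b R * powr_sum a b (norm (fst p - snd p))"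
        using \<open>\<epsilon> > 0\<close> by (intro powr_sum_mult_le) (auto simp: R)
      finally have "norm (\<psi> (transpose (fst p - snd p) *v u)) \<le> K * (powr_sum a b R * powr_sum a b (norm (fst p - snd p)))"
        using \<psi>[of "transpose (fst p - snd p) *v u"] \<open>K \<ge> 0\<close> by (meson mult_left_mono order_trans)
      moreover have "measure lborel (A \<inter> ?C p) \<le> measure lborel (?C p)"
        using admC[OF p] A by (intro measure_mono_fmeasurable) (auto simp: adm_def fmeasurable_def)
      ultimately show "norm (complex_of_real (measure lborel (A \<inter> ?C p)) * \<psi> (transpose (fst p - snd p) *v u))
          \<le> measure lborel (?C p) * (K * (powr_sum a b R * powr_sum a b (norm (fst p - snd p))))"
        by (simp add: norm_mult mult_mono)
    qed
    also have "\<dots> = J"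
      unfolding J integral_powr_sum_level[OF G H] by (simp add: sum_distrib_left mult_ac)
    finally have "norm ?z \<le> J" .
    then have "norm (exp ?z - 1) \<le> 2 * norm ?z"
      using small by (intro norm_exp_minus_one_le) linarith
    with \<open>norm ?z \<le> J\<close> show ?thesis unfolding eq by linarith
  qed
  have "measure P {\<omega>\<in>space P. norm (level_int Mr G A \<omega> - level_int Mr H A \<omega>) > \<epsilon>} \<le> 2 * real CARD('n) * (2 * J)"
    using ch \<open>\<epsilon> > 0\<close> Jnn unfolding R
    by (intro tail_bound_charfun borel_measurable_diff level_int_measurable G H A) auto
  then show ?thesis by simp
qed

end

section \<open>A moment condition for integrability\<close>

lemma integrable_powr_sum_scale:
  assumes "integrable M (\<lambda>y. powr_sum a b (norm (f y)))" "c \<ge> 0" "f \<in> borel_measurable M"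
  shows "integrable M (\<lambda>y. powr_sum a b (c * norm (f y)))"
proof (rule Bochner_Integration.integrable_bound)
  show "integrable M (\<lambda>y. powr_sum a b c * powr_sum a b (norm (f y)))"
    using assms(1) by simp
  show "AE y in M. norm (powr_sum a b (c * norm (f y))) \<le> norm (powr_sum a b c * powr_sum a b (norm (f y)))"
    using assms(2) by (intro AE_I2) (simp add: powr_sum_mult_le)
  show "(\<lambda>y. powr_sum a b (c * norm (f y))) \<in> borel_measurable M"
    using assms(3) by measurable
qed

text \<open>A Chebyshev estimate: on the level of v \<noteq> 0 the integrable function
  \<open>powr_sum a b (2 * norm (f y))\<close> is bounded below by a positive constant.\<close>

lemma level_simple_of_dominated:
  fixes f F :: "real^'d \<Rightarrow> real^'n^'n"
  assumes "simple_function lborel F" and dom: "\<And>y. norm (F y) \<le> 2 * norm (f y)"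
    and int: "integrable lborel (\<lambda>y. powr_sum a b (norm (f y)))" and ab: "a > 0" "b > 0"
    and [measurable]: "f \<in> borel_measurable lborel"
  shows "level_simple F"
  unfolding level_simple_def
proof (intro conjI allI impI)
  fix v :: "real^'n^'n" assume "v \<noteq> 0"
  let ?c = "powr_sum a b (norm v)"
  have "?c > 0" using \<open>v \<noteq> 0\<close> by (simp add: powr_sum_def add_pos_pos)
  have S: "F -` {v} \<in> sets lborel"
    using simple_functionD(2)[OF assms(1), of "{v}"] by simp
  have int2: "integrable lborel (\<lambda>y. powr_sum a b (2 * norm (f y)))"
    by (intro integrable_powr_sum_scale int) auto
  have "ennreal ?c * emeasure lborel (F -` {v}) = (\<integral>\<^sup>+y. ennreal ?c * indicator (F -` {v}) y \<partial>lborel)"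
    using S by (simp add: nn_integral_cmult_indicator)
  also have "\<dots> \<le> (\<integral>\<^sup>+y. ennreal (powr_sum a b (2 * norm (f y))) \<partial>lborel)"
  proof (rule nn_integral_mono)
    fix y
    show "ennreal ?c * indicator (F -` {v}) y \<le> ennreal (powr_sum a b (2 * norm (f y)))"
      using dom[of y] ab by (auto intro!: ennreal_leI powr_sum_mono split: split_indicator)
  qed
  also have "\<dots> < \<infinity>"
    using int2 by (simp add: integrable_iff_bounded)
  finally have "emeasure lborel (F -` {v}) < \<infinity>"
    using \<open>?c > 0\<close> by (auto simp: ennreal_mult_less_top)
  with S show "adm (F -` {v})" by (simp add: adm_def)
qed (rule assms(1))

lemma convergent_of_summable_increments:
  fixes X :: "nat \<Rightarrow> 'a::banach"
  assumes "eventually (\<lambda>n. norm (X (Suc n) - X n) \<le> (1/2) ^ n) sequentially"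
  shows "convergent X"
proof -
  have "summable (\<lambda>n. X (Suc n) - X n)"
  proof (rule summable_comparison_test_ev[OF assms])
    show "summable (\<lambda>n. (1/2::real) ^ n)" by (rule summable_geometric) simp
  qed
  then have "convergent (\<lambda>n. \<Sum>k<n. X (Suc k) - X k)"
    by (simp add: summable_iff_convergent)
  then have "convergent (\<lambda>n. X n - X 0)" by (simp add: sum_lessThan_telescope)
  then have "convergent (\<lambda>n. (X n - X 0) + X 0)"
    by (intro convergent_add convergent_const)
  then show ?thesis by simp
qed

text \<open>Dominated convergence is applied to the indicators of the deviation events.\<close>

lemma conv_in_prob_of_AE:
  assumes "prob_space P" and X: "\<And>n. X n \<in> borel_measurable P"
    and "AE \<omega> in P. convergent (\<lambda>n. X n \<omega>)"
  shows "conv_in_prob P X (\<lambda>\<omega>. lim (\<lambda>n. X n \<omega>))"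
  unfolding conv_in_prob_def
proof (intro conjI allI impI)
  interpret prob_space P by fact
  note [measurable] = X
  let ?Y = "\<lambda>\<omega>. lim (\<lambda>n. X n \<omega>)"
  show [measurable]: "?Y \<in> borel_measurable P" by measurable
  fix e :: real assume "e > 0"
  have "(\<lambda>n. \<integral>\<omega>. indicator {\<omega>\<in>space P. dist (X n \<omega>) (?Y \<omega>) > e} \<omega> \<partial>P) \<longlonglongrightarrow> (\<integral>\<omega>. (0::real) \<partial>P)"
  proof (rule integral_dominated_convergence[where w="\<lambda>_. 1"])
    show "AE \<omega> in P. (\<lambda>n. indicator {\<omega>\<in>space P. dist (X n \<omega>) (?Y \<omega>) > e} \<omega> :: real) \<longlonglongrightarrow> 0"
      using assms(3)
    proof eventually_elim
      case (elim \<omega>)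
      then have "(\<lambda>n. X n \<omega>) \<longlonglongrightarrow> ?Y \<omega>" by (simp add: convergent_LIMSEQ_iff)
      then have "eventually (\<lambda>n. dist (X n \<omega>) (?Y \<omega>) < e) sequentially"
        using \<open>e > 0\<close> by (simp add: tendsto_iff)
      then have "eventually (\<lambda>n. indicator {\<omega>\<in>space P. dist (X n \<omega>) (?Y \<omega>) > e} \<omega> = (0::real)) sequentially"
        by eventually_elim (auto simp: indicator_def)
      then show ?case by (simp add: tendsto_eventually)
    qed
  qed (auto simp: indicator_def)
  then show "(\<lambda>n. prob {\<omega>\<in>space P. dist (X n \<omega>) (?Y \<omega>) > e}) \<longlonglongrightarrow> 0"
    by simp
qed

text \<open>Approximants F i give differences that are Cauchy in probability uniformly in A. A
  subsequence with summable deviation probabilities is fixed once; for each A separately,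
  Borel-Cantelli turns it into an almost surely convergent one.\<close>

theorem KS_integrable_of_powr_bound:
  fixes f :: "real^'d \<Rightarrow> real^'n^'n" and Mr :: "(real^'d) set \<Rightarrow> 'w \<Rightarrow> real^'n"
  assumes rm: "indep_scattered_rm P Mr \<psi>"
    and \<psi>: "\<And>u. norm (\<psi> u) \<le> K * powr_sum a b (norm u)" and K: "K \<ge> 0" and ab: "a > 0" "b > 0"
    and f [measurable]: "f \<in> borel_measurable lborel"
    and int: "integrable lborel (\<lambda>y. powr_sum a b (norm (f y)))"
  shows "KS_integrable P Mr f"
proof -
  interpret prob_space P using rm by (simp add: indep_scattered_rm_def)
  obtain F where simple: "\<And>i. simple_function lborel (F i)" and lim: "\<And>y. (\<lambda>i. F i y) \<longlonglongrightarrow> f y"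
    and dom: "\<And>i y. norm (F i y) \<le> 2 * norm (f y)"
    using borel_measurable_implies_sequence_metric[OF f, of 0] by auto
  have lev: "level_simple (F i)" for i
    by (rule level_simple_of_dominated[OF simple dom int ab f])
  have [measurable]: "F i \<in> borel_measurable lborel" for i
    by (rule borel_measurable_simple_function[OF simple])
  define J where "J i = (\<integral>y. powr_sum a b (2 * norm (F i y - f y)) \<partial>lborel)" for i
  \<comment> \<open>The constant 6 is 2 (2 + 1): twice the sum of |F i y| \<le> 2 |f y| and |f
    y|.\<close>
  have bound: "powr_sum a b (2 * norm (F i y - f y)) \<le> powr_sum a b (6 * norm (f y))" for i y
    using norm_triangle_ineq4[of "F i y" "f y"] dom[of i y] ab by (intro powr_sum_mono) auto
  have int6: "integrable lborel (\<lambda>y. powr_sum a b (6 * norm (f y)))"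
    by (intro integrable_powr_sum_scale int) auto
  have intd: "integrable lborel (\<lambda>y. powr_sum a b (2 * norm (F i y - f y)))" for i
    by (rule Bochner_Integration.integrable_bound[OF int6]) (auto simp: bound)
  have "J \<longlonglongrightarrow> (\<integral>y. 0 \<partial>(lborel :: (real^'d) measure))"
    unfolding J_def
  proof (rule integral_dominated_convergence[OF _ _ int6])
    show "AE y in lborel. (\<lambda>i. powr_sum a b (2 * norm (F i y - f y))) \<longlonglongrightarrow> 0"
    proof (rule AE_I2)
      fix y
      have "(\<lambda>i. 2 * norm (F i y - f y)) \<longlonglongrightarrow> 2 * norm (f y - f y)"
        by (intro tendsto_intros lim)
      moreover have "continuous_on {0..} (\<lambda>r. powr_sum a b r)"
        using ab by (intro continuous_intros) auto
      ultimately have "(\<lambda>i. powr_sum a b (2 * norm (F i y - f y))) \<longlonglongrightarrow> powr_sum a b (2 * norm (f y - f y))"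
        by (intro continuous_on_tendsto_compose[of "{0..}" "powr_sum a b"]) auto
      then show "(\<lambda>i. powr_sum a b (2 * norm (F i y - f y))) \<longlonglongrightarrow> 0" by simp
    qed
  qed (auto simp: bound)
  then have J0: "J \<longlonglongrightarrow> 0" by simp
  have diff: "(\<integral>y. powr_sum a b (norm (F i y - F j y)) \<partial>lborel) \<le> J i + J j" for i j
  proof -
    have pw: "powr_sum a b (norm (F i y - F j y)) \<le> powr_sum a b (2 * norm (F i y - f y)) + powr_sum a b (2 * norm (F j y - f y))" for y
    proof -
      have "norm (F i y - F j y) \<le> norm (F i y - f y) + norm (F j y - f y)"
        using norm_triangle_ineq4[of "F i y - f y" "F j y - f y"] by simp
      then have "powr_sum a b (norm (F i y - F j y)) \<le> powr_sum a b (norm (F i y - f y) + norm (F j y - f y))"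
        using ab by (intro powr_sum_mono) auto
      also have "\<dots> \<le> powr_sum a b (2 * norm (F i y - f y)) + powr_sum a b (2 * norm (F j y - f y))"
        using ab by (intro powr_sum_add_le) auto
      finally show ?thesis .
    qed
    have "(\<integral>y. powr_sum a b (norm (F i y - F j y)) \<partial>lborel)
        \<le> (\<integral>y. powr_sum a b (2 * norm (F i y - f y)) + powr_sum a b (2 * norm (F j y - f y)) \<partial>lborel)"
    proof (rule integral_mono)
      show "integrable lborel (\<lambda>y. powr_sum a b (norm (F i y - F j y)))"
        by (rule Bochner_Integration.integrable_bound[OF Bochner_Integration.integrable_add[OF intd[of i] intd[of j]]])
           (auto intro: order_trans[OF pw])
    qed (auto intro: intd pw)
    also have "\<dots> = J i + J j" unfolding J_def by (intro Bochner_Integration.integral_add intd)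
    finally show ?thesis .
  qed
  define cauchy where "cauchy n k \<longleftrightarrow> (\<forall>i\<ge>k. \<forall>j\<ge>k. \<forall>A\<in>sets lborel.
      prob {\<omega>\<in>space P. norm (level_int Mr (F i) A \<omega> - level_int Mr (F j) A \<omega>) > (1/2)^n} \<le> (1/2)^n)"
    for n k :: nat
  have "\<exists>k. cauchy n k" for n
  proof -
    define R where "R = 2 * real CARD('n) / (1/2)^n"
    define c where "c = K * powr_sum a b R"
    define N where "N = 4 * real CARD('n)"
    have "c \<ge> 0" using K by (simp add: c_def)
    have "real CARD('n) \<ge> 1" using zero_less_card_finite[where 'a='n] by linarith
    then have "N > 1" unfolding N_def by linarith
    \<comment> \<open>With J i and J j below \<delta>, the quantity I below is at most (1/2)^n / (2
      N). This yields both I \<le> 1/2, as the tail estimate requires, and N I \<le> (1/2)^n. The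
      summand 1 in c + 1 prevents division by zero.\<close>
    define \<delta> where "\<delta> = (1/2)^n / (4 * N * (c + 1))"
    have "\<delta> > 0" using \<open>c \<ge> 0\<close> \<open>N > 1\<close> by (simp add: \<delta>_def)
    then obtain k where k: "\<And>i. i \<ge> k \<Longrightarrow> J i < \<delta>"
      using order_tendstoD(2)[OF J0, of \<delta>] by (auto simp: eventually_sequentially)
    show ?thesis
      unfolding cauchy_def
    proof (intro exI[of _ k] allI impI ballI)
      fix i j A assume ij: "i \<ge> k" "j \<ge> k" and A: "A \<in> sets (lborel :: (real^'d) measure)"
      define I where "I = c * (\<integral>y. powr_sum a b (norm (F i y - F j y)) \<partial>lborel)"
      have "I \<le> c * (2 * \<delta>)"
        unfolding I_def using diff[of i j] k[OF ij(1)] k[OF ij(2)] \<open>c \<ge> 0\<close> by (intro mult_left_mono) auto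
      also have "\<dots> \<le> (c + 1) * (2 * \<delta>)"
        using \<open>\<delta> > 0\<close> by (intro mult_right_mono) auto
      also have "\<dots> = (1/2)^n / (2 * N)"
      proof -
        have "x * (2 * (h / (4 * N * x))) = h / (2 * N)" if "x \<noteq> 0" for x h :: real
          using \<open>N > 1\<close> that by (simp add: field_simps)
        from this[of "c + 1"] show ?thesis using \<open>c \<ge> 0\<close> by (simp add: \<delta>_def)
      qed
      finally have I: "I \<le> (1/2)^n / (2 * N)" .
      have "(1/2::real)^n \<le> 1" by (simp add: power_le_one)
      have "I * (2 * N) \<le> (1/2)^n"
        using I \<open>N > 1\<close> by (simp add: pos_le_divide_eq)
      have "I \<le> 1/2"
      proof -
        have "(1/2::real)^n / (2 * N) \<le> 1 / 2"
          using \<open>(1/2::real)^n \<le> 1\<close> \<open>N > 1\<close> by (intro frac_le) auto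
        with I show ?thesis by linarith
      qed
      have "I \<ge> 0" unfolding I_def using \<open>c \<ge> 0\<close> by (intro mult_nonneg_nonneg) auto
      have "prob {\<omega>\<in>space P. norm (level_int Mr (F i) A \<omega> - level_int Mr (F j) A \<omega>) > (1/2)^n} \<le> 4 * real CARD('n) * I"
        using \<open>I \<le> 1/2\<close>
        by (intro level_int_tail[OF rm \<psi> K ab lev lev A _ R_def]) (auto simp: I_def c_def)
      also have "\<dots> = N * I" by (simp add: N_def)
      also have "\<dots> \<le> I * (2 * N)" using \<open>I \<ge> 0\<close> \<open>N > 1\<close> by simp
      also have "\<dots> \<le> (1/2)^n" by fact
      finally show "prob {\<omega>\<in>space P. norm (level_int Mr (F i) A \<omega> - level_int Mr (F j) A \<omega>) > (1/2)^n} \<le> (1/2)^n" .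
    qed
  qed
  then obtain k where "\<And>n. cauchy n (k n)" by metis
  then have k: "prob {\<omega>\<in>space P. norm (level_int Mr (F i) A \<omega> - level_int Mr (F j) A \<omega>) > (1/2)^n} \<le> (1/2)^n"
    if "i \<ge> k n" "j \<ge> k n" "A \<in> sets lborel" for n i j A
    using that by (simp add: cauchy_def)
  \<comment> \<open>The partial sums make both r n and r (n + 1) at least k n, so consecutive
    members are comparable at level n; the summand n forces r to infinity, which preserves the
    convergence to f.\<close>
  define r where "r n = n + (\<Sum>m\<le>n. k m)" for n :: nat
  have r: "r n \<ge> k n" "r (Suc n) \<ge> k n" "r n \<ge> n" for n
    using member_le_sum[of n "{..n}" k] by (auto simp: r_def)
  have r_lim: "filterlim r at_top sequentially"
    by (rule filterlim_at_top_mono[OF filterlim_ident]) (simp add: r(3))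
  have conv: "conv_in_prob P (\<lambda>n. level_int Mr (F (r n)) A) (\<lambda>\<omega>. lim (\<lambda>n. level_int Mr (F (r n)) A \<omega>))"
    if A: "A \<in> sets lborel" for A
  proof (rule conv_in_prob_of_AE)
    have [measurable]: "level_int Mr (F i) A \<in> borel_measurable P" for i
      by (rule level_int_measurable[OF rm lev A])
    show "level_int Mr (F (r n)) A \<in> borel_measurable P" for n by measurable
    let ?B = "\<lambda>n. {\<omega>\<in>space P. norm (level_int Mr (F (r (Suc n))) A \<omega> - level_int Mr (F (r n)) A \<omega>) > (1/2)^n}"
    have "AE \<omega> in P. eventually (\<lambda>n. \<omega> \<in> space P - ?B n) sequentially"
    proof (rule borel_cantelli_AE1)
      show "?B n \<in> sets P" for n by measurable
      show "emeasure P (?B n) < \<infinity>" for n by (simp add: emeasure_eq_measure)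
      show "summable (\<lambda>n. prob (?B n))"
      proof (rule summable_comparison_test)
        show "\<exists>N. \<forall>n\<ge>N. norm (prob (?B n)) \<le> (1/2)^n"
          using k[OF r(2) r(1) A] by simp
        show "summable (\<lambda>n. (1/2::real) ^ n)" by (rule summable_geometric) simp
      qed
    qed
    then show "AE \<omega> in P. convergent (\<lambda>n. level_int Mr (F (r n)) A \<omega>)"
    proof eventually_elim
      case (elim \<omega>)
      show ?case
        by (rule convergent_of_summable_increments, use elim in eventually_elim) (auto simp: not_less)
    qed
  qed (rule prob_space_axioms)
  have "\<exists>S. simple_valid S \<and> simple_fun S = F i \<and> (\<forall>A. simple_int Mr S A = level_int Mr (F i) A)" for i
    using level_simple_list[OF lev[of i]] by metis
  then obtain S where S: "\<And>i. simple_valid (S i)" "\<And>i. simple_fun (S i) = F i"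
      "\<And>i A. simple_int Mr (S i) A = level_int Mr (F i) A"
    by metis
  show ?thesis
    unfolding KS_integrable_def
  proof (intro conjI exI[of _ "\<lambda>n. S (r n)"] allI ballI)
    show "AE x in lborel. (\<lambda>n. simple_fun (S (r n)) x) \<longlonglongrightarrow> f x"
      unfolding S by (intro AE_I2 filterlim_compose[OF lim r_lim])
    show "\<exists>Y. conv_in_prob P (\<lambda>n. simple_int Mr (S (r n)) A) Y" if "A \<in> sets lborel" for A
      unfolding S using conv[OF that] by blast
  qed (auto intro: S f)
qed

section \<open>Operator-stable exponents\<close>

lemma cmat_mexp_eigenvector:
  fixes A :: "real^'n^'n"
  assumes z: "cmat A *v z = l *s z"
  shows "cmat (mexp t A) *v z = exp (complex_of_real t * l) *s z"
proof -
  have "linear (\<lambda>M::real^'n^'n. cmat M *v z)"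
    by (rule linearI)
       (simp_all add: vec_eq_iff cmat_def matrix_vector_mult_def sum.distrib algebra_simps
         sum_distrib_left scaleR_conv_of_real[where 'a=complex])
  then have bl: "bounded_linear (\<lambda>M::real^'n^'n. cmat M *v z)"
    by (simp add: linear_conv_bounded_linear)
  have pow: "cmat (mpow A k) *v z = l ^ k *s z" for k
  proof (induction k)
    case (Suc k)
    have "cmat (mpow A (Suc k)) *v z = cmat (mpow A k) *v (cmat A *v z)"
      by (simp add: mpow_Suc cmat_mult matrix_vector_mul_assoc)
    then show ?case
      by (simp add: z vector_scalar_commute Suc vector_smult_assoc)
  qed (simp add: cmat_mat_1)
  have "(\<lambda>k. cmat ((t ^ k / fact k) *\<^sub>R mpow A k) *v z) sums (cmat (mexp t A) *v z)"
    unfolding mexp_def by (rule bounded_linear.sums[OF bl summable_sums[OF summable_mexp]])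
  moreover have "cmat ((t ^ k / fact k) *\<^sub>R mpow A k) *v z = ((complex_of_real t * l) ^ k /\<^sub>R fact k) *s z" for k
  proof -
    have "cmat ((t ^ k / fact k) *\<^sub>R mpow A k) *v z = (t ^ k / fact k) *\<^sub>R (cmat (mpow A k) *v z)"
      by (rule linear_cmul[OF bounded_linear.linear[OF bl]])
    then show ?thesis
      unfolding pow by (simp add: vec_eq_iff scaleR_conv_of_real[where 'a=complex] power_mult_distrib field_simps)
  qed
  moreover have "(\<lambda>k. ((complex_of_real t * l) ^ k /\<^sub>R fact k) *s z) sums (exp (complex_of_real t * l) *s z)"
    by (intro bounded_linear.sums[OF bounded_bilinear.bounded_linear_left[OF bounded_bilinear_vector_smult]] exp_converges)
  ultimately show ?thesis by (simp add: sums_iff)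
qed

definition re_vec :: "complex^'n \<Rightarrow> real^'n" where
  "re_vec z = (\<chi> i. Re (z $ i))"

lemma norm_re_vec_le: "norm (re_vec z) \<le> norm z"
  unfolding norm_vec_def re_vec_def by (rule L2_set_mono) (auto simp: abs_Re_le_cmod)

lemma re_vec_matrix_mult: "re_vec (cmat A *v z) = A *v re_vec z"
  by (simp add: vec_eq_iff re_vec_def cmat_def matrix_vector_mult_def)

text \<open>Stability is given for characteristic functions, so for \<psi> it holds only modulo 2 pi
  i. The discrepancy is continuous in t with values in a discrete set, hence constant, and it
  vanishes at t = 0.\<close>

lemma psi_mexp_scaling:
  assumes psi: "log_charfun \<mu> \<psi>"
    and stable: "\<forall>s>0. \<forall>u. exp (complex_of_real s * \<psi> u) = charfun_v \<mu> (matrix_cpow s B *v u)"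
  shows "\<psi> (mexp t B *v u) = complex_of_real (exp t) * \<psi> u"
proof -
  have cont: "continuous_on UNIV \<psi>" and eq: "\<And>u. charfun_v \<mu> u = exp (\<psi> u)"
    using psi by (auto simp: log_charfun_def)
  define g where "g t = \<psi> (mexp t B *v u) - complex_of_real (exp t) * \<psi> u" for t
  have g1: "exp (g t) = 1" for t
    using stable[rule_format, of "exp t" u] by (simp add: g_def exp_diff eq matrix_cpow_eq_mexp)
  have "g constant_on UNIV"
  proof (rule continuous_discrete_range_constant)
    have "continuous_on UNIV (\<lambda>t. mexp t B *v u)"
      by (intro bounded_bilinear.continuous_on[OF bounded_bilinear_matrix_vector] continuous_intros)
    then show "continuous_on UNIV g"
      unfolding g_def by (intro continuous_intros continuous_on_compose2[OF cont]) auto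
    fix t
    have "2 * pi \<le> norm (g s - g t)" if "g s \<noteq> g t" for s
    proof -
      have "exp (g s - g t) = 1" by (simp add: exp_diff g1)
      then obtain n :: int where n: "Re (g s - g t) = 0" "Im (g s - g t) = of_int (2 * n) * pi"
        unfolding exp_eq_1 by blast
      have "n \<noteq> 0" using that n by (auto simp: complex_eq_iff)
      then have "\<bar>real_of_int n\<bar> \<ge> 1" by linarith
      then have "2 * pi \<le> \<bar>Im (g s - g t)\<bar>" unfolding n(2) by (simp add: abs_mult)
      also have "\<dots> \<le> norm (g s - g t)" by (rule abs_Im_le_cmod)
      finally show ?thesis .
    qed
    then show "\<exists>e>0. \<forall>s. s \<in> UNIV \<and> g s \<noteq> g t \<longrightarrow> e \<le> norm (g s - g t)"
      by (intro exI[of _ "2 * pi"]) auto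
  qed simp
  then have "g t = g 0" by (auto simp: constant_on_def)
  then show ?thesis by (simp add: g_def)
qed

lemma psi_zero_of_nonpos_eigenvalue:
  fixes B :: "real^'n^'n"
  assumes cont: "continuous_on UNIV \<psi>"
    and scal: "\<And>t u. \<psi> (mexp t B *v u) = complex_of_real (exp t) * \<psi> u"
    and z: "cmat B *v z = l *s z" and l: "Re l \<le> 0"
  shows "\<psi> (re_vec z) = 0"
proof -
  have "compact (\<psi> ` cball 0 (norm z))"
    by (intro compact_continuous_image continuous_on_subset[OF cont]) auto
  then obtain D where D: "\<And>v. norm v \<le> norm z \<Longrightarrow> norm (\<psi> v) \<le> D"
    using compact_imp_bounded[THEN bounded_normE] by (metis image_eqI mem_cball_0)
  have bound: "exp t * norm (\<psi> (re_vec z)) \<le> D" if "t \<ge> 0" for t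
  proof -
    have "norm (mexp t B *v re_vec z) = norm (re_vec (cmat (mexp t B) *v z))"
      by (simp add: re_vec_matrix_mult)
    also have "\<dots> \<le> norm (exp (complex_of_real t * l) *s z)"
      unfolding cmat_mexp_eigenvector[OF z] by (rule norm_re_vec_le)
    also have "\<dots> = exp (t * Re l) * norm z" by (simp add: norm_vector_smult)
    also have "\<dots> \<le> 1 * norm z"
      using that l by (intro mult_right_mono) (auto simp: mult_nonneg_nonpos)
    finally have "norm (\<psi> (mexp t B *v re_vec z)) \<le> D" by (intro D) simp
    then show ?thesis by (simp add: scal norm_mult)
  qed
  show ?thesis
  proof (rule ccontr)
    assume "\<psi> (re_vec z) \<noteq> 0"
    then have pos: "norm (\<psi> (re_vec z)) > 0" by simp
    \<comment> \<open>Chosen so that (1 + t) |\<psi>| exceeds |D|; then exp t \<ge> 1 + t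
      contradicts the uniform bound.\<close>
    define t where "t = \<bar>D\<bar> / norm (\<psi> (re_vec z))"
    have "t \<ge> 0" by (simp add: t_def)
    have "\<bar>D\<bar> < (1 + t) * norm (\<psi> (re_vec z))"
      using pos by (simp add: t_def distrib_right)
    also have "\<dots> \<le> exp t * norm (\<psi> (re_vec z))"
      by (intro mult_right_mono exp_ge_add_one_self) auto
    finally show False using bound[OF \<open>t \<ge> 0\<close>] by linarith
  qed
qed

text \<open>A single frequency only places r in the lattice 2 pi Z. Dividing r by a large integer
  brings it below 1, where 0 is the only lattice point.\<close>

lemma real_zero_of_cos_one:
  fixes r :: real
  assumes "\<And>k::nat. cos (r / real (Suc k)) = 1"
  shows "r = 0"
proof -
  obtain k :: nat where k: "\<bar>r\<bar> < real k" using reals_Archimedean2 by blast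
  then have lt: "\<bar>r / real (Suc k)\<bar> < 1" by (simp add: field_simps)
  obtain n :: int where n: "r / real (Suc k) = of_int n * 2 * pi"
    using assms[of k] cos_one_2pi_int by blast
  have "n = 0"
  proof (rule ccontr)
    assume "n \<noteq> 0"
    then have "\<bar>real_of_int n\<bar> \<ge> 1" by linarith
    then have "\<bar>real_of_int n * 2 * pi\<bar> \<ge> 2 * pi" by (simp add: abs_mult)
    with lt n pi_gt3 show False by linarith
  qed
  with n show ?thesis by simp
qed

text \<open>The nonnegative variable 1 - cos(c u x) has integral 0, so it vanishes almost surely for
  each c, and u x = 0 follows almost surely.\<close>

lemma msupport_subset_of_charfun_one:
  fixes u :: "real^'n"
  assumes "prob_space \<mu>" and sets: "sets \<mu> = sets borel"
    and one: "\<And>c. charfun_v \<mu> (c *\<^sub>R u) = 1"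
  shows "msupport \<mu> \<subseteq> {x. u \<bullet> x = 0}"
proof -
  interpret prob_space \<mu> by fact
  have inner [measurable]: "(\<lambda>x. u \<bullet> x) \<in> borel_measurable \<mu>"
    using sets by (subst measurable_cong_sets[of _ borel]) auto
  have ae: "AE x in \<mu>. cos (c * (u \<bullet> x)) = 1" for c
  proof -
    have int: "integrable \<mu> (\<lambda>x. exp (\<i> * complex_of_real ((c *\<^sub>R u) \<bullet> x)))"
      by (rule integrable_const_bound[of _ 1]) (auto simp: norm_exp_i_times)
    have intc: "integrable \<mu> (\<lambda>x. cos (c * (u \<bullet> x)))"
      by (rule integrable_const_bound[of _ 1]) auto
    have "(\<integral>x. cos (c * (u \<bullet> x)) \<partial>\<mu>) = Re (charfun_v \<mu> (c *\<^sub>R u))"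
      unfolding charfun_v_def using int by (subst integral_Re[symmetric]) (auto simp: Re_exp)
    then have "(\<integral>x. 1 - cos (c * (u \<bullet> x)) \<partial>\<mu>) = 0"
      using intc by (simp add: one prob_space)
    then have "AE x in \<mu>. 1 - cos (c * (u \<bullet> x)) = 0"
      using intc by (subst (asm) integral_nonneg_eq_0_iff_AE) auto
    then show ?thesis by eventually_elim simp
  qed
  \<comment> \<open>The exceptional null set depends on the frequency; countably many frequencies
    share one.\<close>
  have "AE x in \<mu>. \<forall>k::nat. cos (1 / real (Suc k) * (u \<bullet> x)) = 1"
    using ae by (simp only: AE_all_countable) blast
  then have ae0: "AE x in \<mu>. u \<bullet> x = 0"
    by eventually_elim (rule real_zero_of_cos_one, simp)
  show ?thesis
  proof (rule subsetI, rule ccontr)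
    fix x assume x: "x \<in> msupport \<mu>" "x \<notin> {x. u \<bullet> x = 0}"
    then have ux: "u \<bullet> x \<noteq> 0" by simp
    then have "u \<noteq> 0" by auto
    \<comment> \<open>The distance from x to the hyperplane, so the ball misses it and must be
      null.\<close>
    define e where "e = \<bar>u \<bullet> x\<bar> / norm u"
    have "e > 0" using ux \<open>u \<noteq> 0\<close> by (simp add: e_def)
    have "u \<bullet> y \<noteq> 0" if "y \<in> ball x e" for y
    proof
      assume "u \<bullet> y = 0"
      then have "\<bar>u \<bullet> x\<bar> = \<bar>u \<bullet> (x - y)\<bar>" by (simp add: inner_diff_right)
      also have "\<dots> \<le> norm u * norm (x - y)" by (rule Cauchy_Schwarz_ineq2)
      also have "\<dots> < norm u * e" using that \<open>u \<noteq> 0\<close> by (simp add: dist_norm)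
      also have "\<dots> = \<bar>u \<bullet> x\<bar>" using \<open>u \<noteq> 0\<close> by (simp add: e_def)
      finally show False by simp
    qed
    then have "AE y in \<mu>. y \<notin> ball x e" using ae0 by (auto elim!: eventually_mono)
    then have "emeasure \<mu> (ball x e) = 0"
      using sets sets_eq_imp_space_eq[OF sets] by (subst (asm) AE_iff_measurable[of "ball x e"]) auto
    with x(1) \<open>e > 0\<close> show False by (auto simp: msupport_def)
  qed
qed

text \<open>On the real span of an eigenvector with eigenvalue of nonpositive real part the orbits
  \<open>s^B u\<close>, \<open>s \<ge> 1\<close>, are bounded, so \<open>s \<psi>(u) = \<psi>(s^B u)\<close> forces \<open>\<psi> = 0\<close> there; \<open>\<mu>\<close> then lives on a hyperplane.\<close>

lemma stable_exponent_min_re_eig_pos: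
  fixes B :: "real^'n^'n"
  assumes prob: "prob_space \<mu>" and sets: "sets \<mu> = sets borel" and full: "full_measure \<mu>"
    and psi: "log_charfun \<mu> \<psi>"
    and scal: "\<And>t u. \<psi> (mexp t B *v u) = complex_of_real (exp t) * \<psi> u"
  shows "min_re_eig B > 0"
proof (rule ccontr)
  assume "\<not> min_re_eig B > 0"
  then obtain l where l: "l \<in> eigenvalues B" "Re l \<le> 0"
    using min_re_eig_attained[of B] by force
  then obtain z0 where z0: "z0 \<noteq> 0" "cmat B *v z0 = l *s z0" by (auto simp: eigenvalues_def)
  \<comment> \<open>A real matrix commutes with taking real parts. If the real part of the
    eigenvector is zero, multiplication by i brings its imaginary part into that place.\<close>
  obtain z where z: "re_vec z \<noteq> 0" "cmat B *v z = l *s z"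
  proof (cases "re_vec z0 = 0")
    case True
    have "re_vec (\<i> *s z0) \<noteq> 0"
    proof
      assume "re_vec (\<i> *s z0) = 0"
      with True have "z0 = 0" by (simp add: vec_eq_iff re_vec_def complex_eq_iff)
      with z0 show False by simp
    qed
    moreover have "cmat B *v (\<i> *s z0) = l *s (\<i> *s z0)"
      by (simp add: vector_scalar_commute z0 vector_smult_assoc mult.commute)
    ultimately show ?thesis using that by blast
  qed (use z0 that in blast)
  have "charfun_v \<mu> (c *\<^sub>R re_vec z) = 1" for c
  proof -
    have "cmat B *v (complex_of_real c *s z) = l *s (complex_of_real c *s z)"
      by (simp add: vector_scalar_commute z vector_smult_assoc mult.commute)
    then have "\<psi> (re_vec (complex_of_real c *s z)) = 0"
      using psi l(2) by (intro psi_zero_of_nonpos_eigenvalue[OF _ scal]) (auto simp: log_charfun_def)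
    moreover have "re_vec (complex_of_real c *s z) = c *\<^sub>R re_vec z"
      by (simp add: vec_eq_iff re_vec_def)
    ultimately show ?thesis using psi by (simp add: log_charfun_def)
  qed
  from msupport_subset_of_charfun_one[OF prob sets this] full z(1) show False
    unfolding full_measure_def by blast
qed

text \<open>For u = exp(t B) \<theta> with |\<theta>| = 1, scaling gives |\<psi> u| \<le> D exp t,
  so t must be controlled by |u|. Since \<theta> = exp(- t B) u, one has 1 \<le> |exp(- t B)| |u|:
  the decay rate \<beta> handles t \<ge> 0 and gives the power 1/\<beta>, a growth rate \<rho>
  handles t < 0 and gives 1/\<rho>.\<close>

lemma psi_powr_bound:
  fixes B :: "real^'n^'n"
  assumes cont: "continuous_on UNIV \<psi>" and zero: "\<psi> 0 = (0::complex)"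
    and scal: "\<And>t u. \<psi> (mexp t B *v u) = complex_of_real (exp t) * \<psi> u"
    and \<beta>: "0 < \<beta>" "\<beta> < min_re_eig B"
  shows "\<exists>K\<ge>0. \<exists>b>0. b \<le> 1 / \<beta> \<and> (\<forall>u. norm (\<psi> u) \<le> K * powr_sum (1 / \<beta>) b (norm u))"
proof -
  obtain C1 where "C1 > 0" and C1: "\<And>t. t \<le> 0 \<Longrightarrow> norm (mexp t B) \<le> C1 * exp (\<beta> * t)"
    using mexp_decay[OF \<beta>(2)] by blast
  obtain C2 \<rho>0 where "C2 > 0" and C2': "\<And>t. t \<ge> 0 \<Longrightarrow> norm (mexp t B) \<le> C2 * exp (\<rho>0 * t)"
    using mexp_growth_all[of B] by blast
  \<comment> \<open>Raising the rate to at least \<beta> secures b \<le> a.\<close>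
  define \<rho> where "\<rho> = max \<rho>0 \<beta>"
  have "\<rho> > 0" "\<rho> \<ge> \<beta>" using \<beta> by (auto simp: \<rho>_def)
  have C2: "norm (mexp t B) \<le> C2 * exp (\<rho> * t)" if "t \<ge> 0" for t
  proof -
    have "C2 * exp (\<rho>0 * t) \<le> C2 * exp (\<rho> * t)"
      using that \<open>C2 > 0\<close> by (auto simp: \<rho>_def intro!: mult_left_mono mult_right_mono)
    then show ?thesis using C2'[OF that] by linarith
  qed
  define a where "a = 1 / \<beta>"
  define b where "b = 1 / \<rho>"
  have ab: "a > 0" "b > 0" "b \<le> a"
    using \<beta> \<open>\<rho> > 0\<close> \<open>\<rho> \<ge> \<beta>\<close> by (auto simp: a_def b_def frac_le)
  have "compact (\<psi> ` sphere 0 1)"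
    by (intro compact_continuous_image continuous_on_subset[OF cont]) auto
  then obtain D where "D > 0" and D: "\<And>v. norm v = 1 \<Longrightarrow> norm (\<psi> v) \<le> D"
    using compact_imp_bounded[THEN bounded_normE_less] by (metis image_eqI mem_sphere_0 less_imp_le)
  have powr_le: "exp t \<le> r powr (1 / k)" if "exp (k * t) \<le> r" "k > 0" for r k t :: real
  proof -
    have "exp t = exp (k * t) powr (1 / k)" using that by (simp add: powr_def)
    also have "\<dots> \<le> r powr (1 / k)" using that by (intro powr_mono2) auto
    finally show ?thesis .
  qed
  define K where "K = D * (C1 powr a + C2 powr b)"
  have "K \<ge> 0" using \<open>D > 0\<close> by (simp add: K_def)
  have "norm (\<psi> u) \<le> K * powr_sum a b (norm u)" for u
  proof (cases "u = 0")
    case False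
    have "min_re_eig B > 0" using \<beta> by linarith
    from mexp_polar[OF this False] obtain t \<theta> where \<theta>: "norm \<theta> = 1" and u: "u = mexp t B *v \<theta>" by blast
    have "\<theta> = mexp (- t) B *v u" by (simp add: u matrix_vector_mul_assoc)
    then have one: "1 \<le> norm (mexp (- t) B) * norm u"
      using norm_matrix_vector_le[of "mexp (- t) B" u] \<theta> by simp
    have "exp t \<le> (C1 powr a + C2 powr b) * powr_sum a b (norm u)"
    proof (cases "t \<ge> 0")
      case True
      have "1 \<le> C1 * exp (\<beta> * (- t)) * norm u"
        using C1[of "- t"] True one by (meson mult_right_mono norm_ge_zero order_trans neg_le_0_iff_le)
      then have "exp (\<beta> * t) \<le> C1 * norm u" by (simp add: exp_minus field_simps)
      then have "exp t \<le> (C1 * norm u) powr a" unfolding a_def using \<beta> by (intro powr_le) auto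
      also have "\<dots> = C1 powr a * norm u powr a" using \<open>C1 > 0\<close> by (simp add: powr_mult)
      also have "\<dots> \<le> (C1 powr a + C2 powr b) * powr_sum a b (norm u)"
        unfolding powr_sum_def by (intro mult_mono) auto
      finally show ?thesis .
    next
      case False
      then have "1 \<le> C2 * exp (\<rho> * (- t)) * norm u"
        using C2[of "- t"] one by (smt (verit, best) mult_right_mono norm_ge_zero)
      then have "exp (\<rho> * t) \<le> C2 * norm u" by (simp add: exp_minus field_simps)
      then have "exp t \<le> (C2 * norm u) powr b" unfolding b_def using \<open>\<rho> > 0\<close> by (intro powr_le) auto
      also have "\<dots> = C2 powr b * norm u powr b" using \<open>C2 > 0\<close> by (simp add: powr_mult)
      also have "\<dots> \<le> (C1 powr a + C2 powr b) * powr_sum a b (norm u)"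
        unfolding powr_sum_def by (intro mult_mono) auto
      finally show ?thesis .
    qed
    moreover have "norm (\<psi> u) \<le> exp t * D"
      unfolding u scal using D[OF \<theta>] by (simp add: norm_mult)
    ultimately have "norm (\<psi> u) \<le> (C1 powr a + C2 powr b) * powr_sum a b (norm u) * D"
      using \<open>D > 0\<close> by (meson mult_right_mono less_imp_le order_trans)
    then show ?thesis by (simp add: K_def mult_ac)
  qed (simp add: zero)
  with \<open>K \<ge> 0\<close> ab show ?thesis unfolding a_def by blast
qed

section \<open>Integrals over sublevel sets of a homogeneous function\<close>

lemma mexp_tendsto_0:
  fixes A :: "real^'n^'n"
  assumes "min_re_eig A > 0"
  shows "((\<lambda>t. mexp t A) \<longlongrightarrow> 0) at_bot"
proof -
  define \<gamma> where "\<gamma> = min_re_eig A / 2"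
  have "\<gamma> > 0" "\<gamma> < min_re_eig A" using assms by (auto simp: \<gamma>_def)
  then obtain C where C: "\<And>t. t \<le> 0 \<Longrightarrow> norm (mexp t A) \<le> C * exp (\<gamma> * t)"
    using mexp_decay by blast
  have "filterlim (\<lambda>t. \<gamma> * t) at_bot at_bot"
    using \<open>\<gamma> > 0\<close> by (intro filterlim_tendsto_pos_mult_at_bot[OF tendsto_const] filterlim_ident)
  then have "((\<lambda>t. C * exp (\<gamma> * t)) \<longlongrightarrow> C * 0) at_bot"
    by (intro tendsto_mult tendsto_const filterlim_compose[OF exp_at_bot])
  then have lim: "((\<lambda>t. C * exp (\<gamma> * t)) \<longlongrightarrow> 0) at_bot" by simp
  show ?thesis
  proof (rule Lim_null_comparison[OF _ lim])
    show "eventually (\<lambda>t. norm (mexp t A) \<le> C * exp (\<gamma> * t)) at_bot"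
      using eventually_le_at_bot[of 0] by eventually_elim (rule C)
  qed
qed

text \<open>As t tends to minus infinity, exp(t tr E) = det(exp(t E)) tends to 0. With a nonpositive
  trace it would stay at least 1 for all t \<le> 0.\<close>

lemma mtrace_pos:
  fixes E :: "real^'d^'d"
  assumes "min_re_eig E > 0"
  shows "mtrace E > 0"
proof (rule ccontr)
  assume "\<not> mtrace E > 0"
  have "((\<lambda>t. det (mexp t E)) \<longlongrightarrow> det (0 :: real^'d^'d)) at_bot"
    unfolding det_def by (intro tendsto_intros mexp_tendsto_0 assms)
  moreover have "det (0 :: real^'d^'d) = 0" by (simp add: det_def power_0_left)
  ultimately have "((\<lambda>t. exp (t * mtrace E)) \<longlongrightarrow> 0) at_bot" by (simp add: det_mexp)
  then have "eventually (\<lambda>t. exp (t * mtrace E) < 1) at_bot"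
    by (rule order_tendstoD) simp
  with eventually_le_at_bot[of "0::real"] have "eventually (\<lambda>t::real. False) at_bot"
  proof eventually_elim
    case (elim t)
    with \<open>\<not> mtrace E > 0\<close> show False using mult_nonpos_nonpos[of t "mtrace E"] by simp
  qed
  then show False by (simp add: trivial_limit_at_bot_linorder)
qed

context
  fixes E :: "real^'d^'d" and \<phi> :: "real^'d \<Rightarrow> real"
  assumes E: "min_re_eig E > 0" and cont: "continuous_on UNIV \<phi>"
    and hom: "\<And>t y. y \<noteq> 0 \<Longrightarrow> \<phi> (mexp t E *v y) = exp t * \<phi> y"
    and pos: "\<And>y. y \<noteq> 0 \<Longrightarrow> \<phi> y > 0"
begin

text \<open>Homogeneity speaks only about nonzero points; the value at the origin comes from
  continuity along an orbit contracting to it.\<close>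

lemma phi_0: "\<phi> 0 = 0"
proof -
  define y :: "real^'d" where "y = axis undefined 1"
  have "y \<noteq> 0" by (simp add: y_def axis_eq_0_iff)
  have "((\<lambda>t. mexp t E *v y) \<longlongrightarrow> 0 *v y) at_bot"
    by (intro bounded_bilinear.tendsto[OF bounded_bilinear_matrix_vector] mexp_tendsto_0 E tendsto_const)
  then have "((\<lambda>t. \<phi> (mexp t E *v y)) \<longlongrightarrow> \<phi> 0) at_bot"
    using cont by (intro continuous_on_tendsto_compose[of UNIV \<phi>]) auto
  moreover have "((\<lambda>t. exp t * \<phi> y) \<longlongrightarrow> 0 * \<phi> y) at_bot"
    by (intro tendsto_mult tendsto_const exp_at_bot)
  ultimately show ?thesis
    using tendsto_unique[of at_bot "\<lambda>t. exp t * \<phi> y" "\<phi> 0" 0] \<open>y \<noteq> 0\<close>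
    by (simp add: hom trivial_limit_at_bot_linorder)
qed

text \<open>Let m > 0 be the minimum of \<phi> on the unit sphere. In polar coordinates \<phi> y
  \<le> 1 forces exp t \<le> 1/m, so t is bounded above, and the matrices exp(t E) are bounded on
  such a half-line.\<close>

lemma phi_sublevel_compact: "compact {y. \<phi> y \<le> 1}"
proof -
  have "closed {y. \<phi> y \<le> 1}"
    using closed_Collect_le[OF cont continuous_on_const] by simp
  moreover have "bounded {y. \<phi> y \<le> 1}"
  proof -
    have "sphere (0::real^'d) 1 \<noteq> {}" by (metis mem_sphere_0 norm_axis_1 empty_iff)
    then obtain \<theta>0 where \<theta>0: "norm \<theta>0 = 1" "\<And>\<theta>. norm \<theta> = 1 \<Longrightarrow> \<phi> \<theta>0 \<le> \<phi> \<theta>"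
      using continuous_attains_inf[of "sphere (0::real^'d) 1" \<phi>] continuous_on_subset[OF cont] by force
    define m where "m = \<phi> \<theta>0"
    have "m > 0" unfolding m_def using \<theta>0(1) by (intro pos) auto
    define T where "T = max 0 (ln (1 / m))"
    have "compact ((\<lambda>t. mexp t E) ` {0..T})"
      by (intro compact_continuous_image continuous_intros) auto
    then obtain C2 where C2: "\<And>t. 0 \<le> t \<Longrightarrow> t \<le> T \<Longrightarrow> norm (mexp t E) \<le> C2"
      using compact_imp_bounded[THEN bounded_normE] by (metis atLeastAtMost_iff image_eqI)
    \<comment> \<open>The rate 0 is admissible here, and plain boundedness for t \<le> 0 is all that
      is wanted.\<close>
    obtain C1 where "C1 > 0" and C1: "\<And>t. t \<le> 0 \<Longrightarrow> norm (mexp t E) \<le> C1 * exp (0 * t)"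
      using mexp_decay[of 0 E] E by blast
    have "norm y \<le> max C1 C2" if y: "\<phi> y \<le> 1" for y
    proof (cases "y = 0")
      case False
      from mexp_polar[OF E False] obtain t \<theta> where \<theta>: "norm \<theta> = 1" and yt: "y = mexp t E *v \<theta>" by blast
      have "\<theta> \<noteq> 0" using \<theta> by auto
      then have "exp t * \<phi> \<theta> \<le> 1" using y by (simp add: yt hom)
      moreover have "exp t * m \<le> exp t * \<phi> \<theta>" using \<theta>0(2)[OF \<theta>] by (simp add: m_def)
      ultimately have "exp t * m \<le> 1" by (rule order_trans[rotated])
      then have "exp t \<le> 1 / m" using \<open>m > 0\<close> by (simp add: field_simps)
      then have "t \<le> ln (1 / m)" using \<open>m > 0\<close> by (simp add: ln_ge_iff)
      then have "t \<le> T" by (simp add: T_def)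
      have "norm y \<le> norm (mexp t E)"
        using norm_matrix_vector_le[of "mexp t E" \<theta>] by (simp add: yt \<theta>)
      also have "\<dots> \<le> max C1 C2"
        using C1[of t] C2[of t] \<open>t \<le> T\<close> by (cases "t \<le> 0") auto
      finally show ?thesis .
    qed (use \<open>C1 > 0\<close> in auto)
    then show ?thesis by (auto simp: bounded_iff)
  qed
  ultimately show ?thesis by (simp add: compact_eq_bounded_closed)
qed

lemma phi_sublevel_scaling: "{y. \<phi> y \<le> exp t} = (*v) (mexp t E) ` {y. \<phi> y \<le> 1}"
proof -
  have hom0: "\<phi> (mexp t E *v y) = exp t * \<phi> y" for t y
    using hom[of y t] by (cases "y = 0") (auto simp: phi_0)
  show ?thesis
  proof (intro equalityI subsetI)
    fix y assume "y \<in> {y. \<phi> y \<le> exp t}"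
    then have "\<phi> (mexp (- t) E *v y) \<le> 1" by (simp add: hom0 exp_minus field_simps)
    then show "y \<in> (*v) (mexp t E) ` {y. \<phi> y \<le> 1}"
      by (intro image_eqI[of _ _ "mexp (- t) E *v y"]) (auto simp: matrix_vector_mul_assoc)
  qed (auto simp: hom0)
qed

lemma emeasure_phi_sublevel:
  assumes "r > 0"
  shows "emeasure lborel {y. \<phi> y \<le> r} = ennreal (r powr mtrace E * measure lborel {y. \<phi> y \<le> 1})"
proof -
  have r: "exp (ln r) = r" using assms by simp
  have c: "compact {y. \<phi> y \<le> r}"
    using phi_sublevel_scaling[of "ln r"] phi_sublevel_compact
    unfolding r by (simp add: compact_continuous_image linear_continuous_on)
  have "measure lebesgue {y. \<phi> y \<le> r} = exp (ln r * mtrace E) * measure lebesgue {y. \<phi> y \<le> 1}"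
    using phi_sublevel_scaling[of "ln r"] measure_mexp_image[OF phi_sublevel_compact, of "ln r" E]
    unfolding r by simp
  moreover have "exp (ln r * mtrace E) = r powr mtrace E"
    using assms by (simp add: powr_def mult.commute)
  ultimately have "measure lborel {y. \<phi> y \<le> r} = r powr mtrace E * measure lborel {y. \<phi> y \<le> 1}"
    using c phi_sublevel_compact by (simp add: measure_completion borel_compact)
  moreover have "emeasure lborel {y. \<phi> y \<le> r} < \<infinity>"
    by (rule emeasure_compact_finite[OF c])
  ultimately show ?thesis by (simp add: emeasure_eq_ennreal_measure)
qed

text \<open>A discrete layer-cake bound: h is dominated by a weighted sum of indicators of sublevel
  sets, whose volumes are known. Whole sublevel sets replace shells, so no volumes have to be
  subtracted. The origin is a null set.\<close>

lemma nn_integral_finite_of_sublevel_cover: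
  fixes h :: "real^'d \<Rightarrow> real"
  assumes cover: "\<And>y. y \<noteq> 0 \<Longrightarrow> h y \<le> 0 \<or> (\<exists>k::nat. h y \<le> c k \<and> \<phi> y \<le> r k)"
    and c: "\<And>k. c k \<ge> 0" and r: "\<And>k. r k > 0"
    and summ: "summable (\<lambda>k. c k * r k powr mtrace E)"
  shows "(\<integral>\<^sup>+y. ennreal (h y) \<partial>lborel) < \<infinity>"
proof -
  have [measurable]: "\<phi> \<in> borel_measurable borel"
    by (rule borel_measurable_continuous_onI[OF cont])
  have "(\<integral>\<^sup>+y. ennreal (h y) \<partial>lborel) \<le> (\<integral>\<^sup>+y. (\<Sum>k. ennreal (c k) * indicator {y. \<phi> y \<le> r k} y) \<partial>lborel)"
  proof (rule nn_integral_mono_AE)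
    have "AE y in lborel. y \<noteq> (0::real^'d)" by (rule AE_lborel_singleton)
    then show "AE y in lborel. ennreal (h y) \<le> (\<Sum>k. ennreal (c k) * indicator {y. \<phi> y \<le> r k} y)"
    proof eventually_elim
      case (elim y)
      show ?case
      proof (cases "h y \<le> 0")
        case True
        then show ?thesis by (simp add: ennreal_neg)
      next
        case False
        then obtain k where k: "h y \<le> c k" "\<phi> y \<le> r k" using cover[OF elim] by blast
        have "ennreal (h y) \<le> (\<Sum>j\<in>{k}. ennreal (c j) * indicator {y. \<phi> y \<le> r j} y)"
          using k by (simp add: ennreal_leI)
        also have "\<dots> \<le> (\<Sum>j. ennreal (c j) * indicator {y. \<phi> y \<le> r j} y)"
          by (rule sum_le_suminf) auto
        finally show ?thesis .
      qed
    qed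
  qed
  also have "\<dots> = (\<Sum>k. \<integral>\<^sup>+y. ennreal (c k) * indicator {y. \<phi> y \<le> r k} y \<partial>lborel)"
    by (rule nn_integral_suminf) measurable
  also have "\<dots> = (\<Sum>k. ennreal (c k * r k powr mtrace E * measure lborel {y. \<phi> y \<le> 1}))"
    by (intro suminf_cong, subst nn_integral_cmult_indicator)
       (auto simp: emeasure_phi_sublevel r c mult.assoc ennreal_mult)
  also have "\<dots> = ennreal (\<Sum>k. c k * r k powr mtrace E * measure lborel {y. \<phi> y \<le> 1})"
    by (rule suminf_ennreal2) (auto intro!: mult_nonneg_nonneg c summable_mult2 summ)
  also have "\<dots> < \<infinity>" by simp
  finally show ?thesis .
qed

text \<open>Dyadic shells 2^(-k-1) < \<phi> \<le> 2^(-k). The factor 2^|p| pays for the variation of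
  \<phi>^p across a shell, whatever the sign of p; the resulting series is geometric with ratio
  2^(-(p + q)).\<close>

lemma nn_integral_phi_powr_small:
  assumes p: "p > - mtrace E"
  shows "(\<integral>\<^sup>+y. ennreal (\<phi> y powr p * indicator {y. \<phi> y \<le> 1} y) \<partial>lborel) < \<infinity>"
proof (rule nn_integral_finite_of_sublevel_cover[where c="\<lambda>k. 2 powr \<bar>p\<bar> * 2 powr (- real k * p)" and r="\<lambda>k. 2 powr (- real k)"])
  fix y :: "real^'d" assume "y \<noteq> 0"
  show "\<phi> y powr p * indicator {y. \<phi> y \<le> 1} y \<le> 0 \<or>
      (\<exists>k::nat. \<phi> y powr p * indicator {y. \<phi> y \<le> 1} y \<le> 2 powr \<bar>p\<bar> * 2 powr (- real k * p) \<and> \<phi> y \<le> 2 powr (- real k))"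
  proof (cases "\<phi> y \<le> 1")
    case True
    define s where "s = log 2 (\<phi> y)"
    have y: "\<phi> y = 2 powr s" using pos[OF \<open>y \<noteq> 0\<close>] by (simp add: s_def)
    have "s \<le> 0" using True pos[OF \<open>y \<noteq> 0\<close>] by (simp add: s_def)
    define k where "k = nat \<lfloor>- s\<rfloor>"
    have k: "real k \<le> - s" "- s < real k + 1" using \<open>s \<le> 0\<close> by (auto simp: k_def)
    have "s * p \<le> \<bar>p\<bar> + - real k * p"
    proof -
      have "(s + real k) * p \<le> \<bar>s + real k\<bar> * \<bar>p\<bar>" by (metis abs_ge_self abs_mult)
      also have "\<dots> \<le> 1 * \<bar>p\<bar>" using k by (intro mult_right_mono) auto
      finally show ?thesis by (simp add: algebra_simps)
    qed
    then have "\<phi> y powr p \<le> 2 powr \<bar>p\<bar> * 2 powr (- real k * p)"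
      unfolding y powr_powr powr_add[symmetric] by (intro powr_mono) auto
    moreover have "\<phi> y \<le> 2 powr (- real k)" unfolding y using k by (intro powr_mono) auto
    ultimately show ?thesis using True by (intro disjI2 exI[of _ k]) auto
  qed simp
next
  have "2 powr \<bar>p\<bar> * 2 powr (- real k * p) * (2 powr (- real k)) powr mtrace E
      = 2 powr \<bar>p\<bar> * (2 powr (- (p + mtrace E))) ^ k" for k
    by (simp add: powr_powr mult.assoc distrib_left algebra_simps flip: powr_add powr_realpow)
  moreover have "summable (\<lambda>k. 2 powr \<bar>p\<bar> * (2 powr (- (p + mtrace E))) ^ k)"
    using p by (intro summable_mult summable_geometric) (simp add: powr_less_one)
  ultimately show "summable (\<lambda>k. 2 powr \<bar>p\<bar> * 2 powr (- real k * p) * (2 powr (- real k)) powr mtrace E)"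
    by (simp only:)
qed auto

text \<open>Dyadic shells 2^k \<le> \<phi> < 2^(k+1): the value is estimated at the inner edge and
  the volume at the outer one, hence the shift in the radius. The ratio is 2^(-(m - q)).\<close>

lemma nn_integral_phi_powr_large:
  assumes m: "m > mtrace E" and "mtrace E > 0"
  shows "(\<integral>\<^sup>+y. ennreal (\<phi> y powr (- m) * indicator {y. \<phi> y > 1} y) \<partial>lborel) < \<infinity>"
proof (rule nn_integral_finite_of_sublevel_cover[where c="\<lambda>k. 2 powr (- real k * m)" and r="\<lambda>k. 2 powr (real k + 1)"])
  fix y :: "real^'d" assume "y \<noteq> 0"
  show "\<phi> y powr (- m) * indicator {y. \<phi> y > 1} y \<le> 0 \<or>
      (\<exists>k::nat. \<phi> y powr (- m) * indicator {y. \<phi> y > 1} y \<le> 2 powr (- real k * m) \<and> \<phi> y \<le> 2 powr (real k + 1))"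
  proof (cases "\<phi> y > 1")
    case True
    define s where "s = log 2 (\<phi> y)"
    have y: "\<phi> y = 2 powr s" using pos[OF \<open>y \<noteq> 0\<close>] by (simp add: s_def)
    have "s \<ge> 0" using True by (simp add: s_def)
    define k where "k = nat \<lfloor>s\<rfloor>"
    have k: "real k \<le> s" "s < real k + 1" using \<open>s \<ge> 0\<close> by (auto simp: k_def)
    have "real k * m \<le> s * m" using k m \<open>mtrace E > 0\<close> by (intro mult_right_mono) auto
    then have "\<phi> y powr (- m) \<le> 2 powr (- real k * m)"
      unfolding y powr_powr by (intro powr_mono) auto
    moreover have "\<phi> y \<le> 2 powr (real k + 1)" unfolding y using k by (intro powr_mono) auto
    ultimately show ?thesis using True by auto
  qed simp
next
  have "2 powr (- real k * m) * (2 powr (real k + 1)) powr mtrace E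
      = 2 powr mtrace E * (2 powr (- (m - mtrace E))) ^ k" for k
    by (simp add: powr_powr distrib_left distrib_right algebra_simps flip: powr_add powr_realpow)
  moreover have "summable (\<lambda>k. 2 powr mtrace E * (2 powr (- (m - mtrace E))) ^ k)"
    using m by (intro summable_mult summable_geometric) (simp add: powr_less_one)
  ultimately show "summable (\<lambda>k. 2 powr (- real k * m) * (2 powr (real k + 1)) powr mtrace E)"
    by (simp only:)
qed auto

end

lemma exp_dominates_powr:
  fixes lam \<rho> :: real
  assumes "lam > 0"
  shows "\<exists>D\<ge>0. \<forall>r\<ge>1. exp (- lam * r) * r powr \<rho> \<le> D"
proof -
  \<comment> \<open>An integer exponent above \<rho> that stays positive even for negative \<rho>,
    because it is a denominator in (1 + x/n)^n \<le> exp x.\<close>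
  define n where "n = nat \<lceil>max 1 \<rho>\<rceil>"
  have n: "n > 0" "\<rho> \<le> real n" by (auto simp: n_def) linarith+
  have "exp (- lam * r) * r powr \<rho> \<le> (real n / lam) ^ n" if "r \<ge> 1" for r
  proof -
    have "(lam * r / real n) ^ n \<le> (1 + lam * r / real n) ^ n"
      using assms that by (intro power_mono) auto
    also have "\<dots> \<le> exp (lam * r)"
      using n assms that by (intro exp_ge_one_plus_x_over_n_power_n) (auto intro: order_trans[of _ 0])
    finally have *: "r ^ n \<le> (real n / lam) ^ n * exp (lam * r)"
      using assms n by (simp add: power_divide power_mult_distrib field_simps)
    have "r powr \<rho> \<le> r powr real n" using that n by (intro powr_mono) auto
    also have "\<dots> = r ^ n" using that by (simp add: powr_realpow)
    finally have "r powr \<rho> \<le> (real n / lam) ^ n * exp (lam * r)" using * by linarith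
    then show ?thesis by (simp add: exp_minus field_simps)
  qed
  moreover have "(real n / lam) ^ n \<ge> 0" using assms by simp
  ultimately show ?thesis by blast
qed

section \<open>Integrability of the kernel\<close>

text \<open>The integral is split at \<phi> = 1. Below, the power s \<gamma> lies above the critical
  value -q; above, tempering is exchanged for a negative power of any chosen order.\<close>

lemma integrable_norm_powr_of_phi_bounds:
  fixes g :: "real^'d \<Rightarrow> real^'n^'n"
  assumes E: "min_re_eig E > 0" and cont: "continuous_on UNIV \<phi>"
    and hom: "\<And>t y. y \<noteq> 0 \<Longrightarrow> \<phi> (mexp t E *v y) = exp t * \<phi> y"
    and pos: "\<And>y. y \<noteq> 0 \<Longrightarrow> \<phi> y > 0"
    and g: "g \<in> borel_measurable lborel"
    and small: "\<And>y. y \<noteq> 0 \<Longrightarrow> \<phi> y \<le> 1 \<Longrightarrow> norm (g y) \<le> C * \<phi> y powr \<gamma>"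
    and large: "\<And>y. y \<noteq> 0 \<Longrightarrow> \<phi> y > 1 \<Longrightarrow> norm (g y) \<le> C * (exp (- lam * \<phi> y) * \<phi> y powr \<rho>)"
    and "C \<ge> 0" "lam > 0" and s: "s > 0" "s * \<gamma> > - mtrace E"
  shows "integrable lborel (\<lambda>y. norm (g y) powr s)"
proof -
  have q: "mtrace E > 0" by (rule mtrace_pos[OF E])
  \<comment> \<open>Makes m s equal to q + 1, safely beyond the critical exponent q at
    infinity.\<close>
  define m where "m = (mtrace E + 1) / s"
  have m: "m * s > mtrace E" using s by (simp add: m_def)
  obtain D where "D \<ge> 0" and D: "\<And>r. r \<ge> 1 \<Longrightarrow> exp (- lam * r) * r powr (\<rho> + m) \<le> D"
    using exp_dominates_powr[OF \<open>lam > 0\<close>] by blast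
  have [measurable]: "g \<in> borel_measurable lborel" "\<phi> \<in> borel_measurable lborel"
    using g borel_measurable_continuous_onI[OF cont] by auto
  define c where "c = C powr s + (C * D) powr s"
  let ?h1 = "\<lambda>y. \<phi> y powr (s * \<gamma>) * indicator {y. \<phi> y \<le> 1} y"
  let ?h2 = "\<lambda>y. \<phi> y powr (- (m * s)) * indicator {y. \<phi> y > 1} y"
  have bound: "norm (g y) powr s \<le> c * (?h1 y + ?h2 y)" if "y \<noteq> 0" for y
  proof (cases "\<phi> y \<le> 1")
    case True
    have "norm (g y) powr s \<le> (C * \<phi> y powr \<gamma>) powr s"
      using small[OF that True] s by (intro powr_mono2) auto
    also have "\<dots> = C powr s * \<phi> y powr (s * \<gamma>)"
      using \<open>C \<ge> 0\<close> by (simp add: powr_mult powr_powr mult.commute)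
    also have "\<dots> \<le> c * \<phi> y powr (s * \<gamma>)"
      by (intro mult_right_mono) (auto simp: c_def)
    finally show ?thesis using True by simp
  next
    case False
    then have y: "\<phi> y > 1" by simp
    have "exp (- lam * \<phi> y) * \<phi> y powr \<rho> = exp (- lam * \<phi> y) * \<phi> y powr (\<rho> + m) * \<phi> y powr (- m)"
      using y by (simp add: mult.assoc flip: powr_add)
    also have "\<dots> \<le> D * \<phi> y powr (- m)"
      using y by (intro mult_right_mono D) auto
    finally have "norm (g y) \<le> C * (D * \<phi> y powr (- m))"
      using large[OF that y] \<open>C \<ge> 0\<close> by (meson mult_left_mono order_trans)
    then have "norm (g y) powr s \<le> (C * (D * \<phi> y powr (- m))) powr s"
      using s by (intro powr_mono2) auto
    also have "\<dots> = (C * D) powr s * \<phi> y powr (- (m * s))"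
      using \<open>C \<ge> 0\<close> \<open>D \<ge> 0\<close> by (simp add: powr_mult powr_powr)
    also have "\<dots> \<le> c * \<phi> y powr (- (m * s))"
      by (intro mult_right_mono) (auto simp: c_def)
    finally show ?thesis using y by simp
  qed
  have fin: "(\<integral>\<^sup>+y. ennreal (?h1 y) \<partial>lborel) < \<infinity>" "(\<integral>\<^sup>+y. ennreal (?h2 y) \<partial>lborel) < \<infinity>"
    using nn_integral_phi_powr_small[OF E cont hom pos s(2)]
      nn_integral_phi_powr_large[OF E cont hom pos m q] by auto
  have int: "integrable lborel ?h1" "integrable lborel ?h2"
    using fin by (auto intro!: integrableI_nonneg)
  show ?thesis
  proof (rule Bochner_Integration.integrable_bound)
    show "integrable lborel (\<lambda>y. c * (?h1 y + ?h2 y))"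
      using int by (intro integrable_mult_right Bochner_Integration.integrable_add)
    have "AE y in lborel. y \<noteq> (0::real^'d)" by (rule AE_lborel_singleton)
    then show "AE y in lborel. norm (norm (g y) powr s) \<le> norm (c * (?h1 y + ?h2 y))"
      by eventually_elim (use bound in \<open>force intro: order_trans[OF _ abs_ge_self]\<close>)
    show "(\<lambda>y. norm (g y) powr s) \<in> borel_measurable lborel" by measurable
  qed
qed

lemma lborel_distr_diff: "distr lborel borel (\<lambda>y::'a::euclidean_space. x - y) = lborel"
  using lborel_affine[of "-1" x] by (simp add: density_1)

lemma integrable_lborel_diff:
  fixes h :: "'a::euclidean_space \<Rightarrow> real"
  assumes "integrable lborel h"
  shows "integrable lborel (\<lambda>y. h (x - y))"
proof -
  have "integrable (distr lborel borel (\<lambda>y. x - y)) h"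
    using assms by (simp add: lborel_distr_diff)
  then show ?thesis
    by (subst (asm) integrable_distr_eq) (use assms in \<open>auto dest: borel_measurable_integrable\<close>)
qed

theorem mainTheorem1:
  fixes E :: "real^'d^'d" and \<phi> :: "real^'d \<Rightarrow> real"
    and H B :: "real^'n^'n" and \<mu> :: "(real^'n) measure" and \<psi> :: "real^'n \<Rightarrow> complex"
    and P :: "'w measure" and Mr :: "(real^'d) set \<Rightarrow> 'w \<Rightarrow> real^'n"
    and lam :: real and x :: "real^'d"
  assumes E_eig: "\<forall>z\<in>eigenvalues E. Re z > 0"
    and phi_cont: "continuous_on UNIV \<phi>"
    and phi_nonneg: "\<forall>y. \<phi> y \<ge> 0"
    and phi_hom: "E_homogeneous E \<phi>"
    and phi_pos: "\<forall>y. y \<noteq> 0 \<longrightarrow> \<phi> y > 0"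
    and H_eig: "min_re_eig H > 0"
    and mu_prob: "prob_space \<mu>" and mu_sets: "sets \<mu> = sets borel"
    and mu_full: "full_measure \<mu>"
    and mu_id: "inf_div \<mu>"
    and psi: "log_charfun \<mu> \<psi>"
    and mu_stable: "\<forall>s>0. \<forall>u. exp (complex_of_real s * \<psi> u) = charfun_v \<mu> (matrix_cpow s B *v u)"
    and M_rm: "indep_scattered_rm P Mr \<psi>"
    and lam_pos: "lam > 0"
    and cond: "min_re_eig (H - mtrace E *\<^sub>R B) + mtrace E * min_re_eig B > 0"
  shows "KS_integrable P Mr
     (\<lambda>y. exp (- lam * \<phi> (x - y)) *\<^sub>R matrix_cpow (\<phi> (x - y)) (H - mtrace E *\<^sub>R B)
        - exp (- lam * \<phi> (- y)) *\<^sub>R matrix_cpow (\<phi> (- y)) (H - mtrace E *\<^sub>R B))"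
proof -
  define D where "D = H - mtrace E *\<^sub>R B"
  define q where "q = mtrace E"
  define w where "w = min_re_eig B"
  define d where "d = min_re_eig D"
  have E: "min_re_eig E > 0" using E_eig min_re_eig_attained[of E] by force
  have q: "q > 0" unfolding q_def by (rule mtrace_pos[OF E])
  have hom: "\<phi> (mexp t E *v y) = exp t * \<phi> y" if "y \<noteq> 0" for t y
    using phi_hom that by (force simp: E_homogeneous_def matrix_cpow_eq_mexp dest: spec[of _ "exp t"])
  have scal: "\<psi> (mexp t B *v u) = complex_of_real (exp t) * \<psi> u" for t u
    by (rule psi_mexp_scaling[OF psi mu_stable])
  have w: "w > 0" unfolding w_def
    by (rule stable_exponent_min_re_eig_pos[OF mu_prob mu_sets mu_full psi scal])
  have dw: "d + q * w > 0" using cond by (simp add: d_def q_def w_def D_def)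
  \<comment> \<open>Lowering both rates by \<epsilon> costs (1 + q) \<epsilon> in \<gamma> + q
    \<beta>; the second bound spends at most half of the available margin, and the first keeps
    \<beta> positive.\<close>
  define \<epsilon> where "\<epsilon> = min (w / 2) ((d + q * w) / (2 * (1 + q)))"
  have "\<epsilon> > 0" using w q dw by (simp add: \<epsilon>_def)
  define \<beta> where "\<beta> = w - \<epsilon>"
  define \<gamma> where "\<gamma> = d - \<epsilon>"
  have "\<epsilon> \<le> w / 2" unfolding \<epsilon>_def by (rule min.cobounded1)
  then have \<beta>: "\<beta> > 0" "\<beta> < min_re_eig B" using w \<open>\<epsilon> > 0\<close> by (auto simp: \<beta>_def w_def)
  have \<gamma>: "\<gamma> < min_re_eig D" using \<open>\<epsilon> > 0\<close> by (simp add: \<gamma>_def d_def)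
  have "\<epsilon> \<le> (d + q * w) / (2 * (1 + q))" unfolding \<epsilon>_def by (rule min.cobounded2)
  then have "\<epsilon> * (1 + q) \<le> (d + q * w) / 2" using q by (simp add: field_simps)
  then have \<gamma>\<beta>: "\<gamma> + q * \<beta> > 0" using dw by (simp add: \<gamma>_def \<beta>_def algebra_simps)
  obtain K b where "K \<ge> 0" and b: "b > 0" "b \<le> 1 / \<beta>"
    and K: "\<And>u. norm (\<psi> u) \<le> K * powr_sum (1 / \<beta>) b (norm u)"
    using psi_powr_bound[OF _ _ scal \<beta>] psi by (auto simp: log_charfun_def)
  define a where "a = 1 / \<beta>"
  have "a > 0" using \<beta> by (simp add: a_def)
  have a\<gamma>: "a * \<gamma> > - q" using \<gamma>\<beta> \<beta> by (simp add: a_def field_simps)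
  \<comment> \<open>For negative \<gamma> the smaller exponent b gives the milder singularity, so
    the bound for a carries over.\<close>
  have b\<gamma>: "b * \<gamma> > - q"
  proof (cases "\<gamma> \<ge> 0")
    case True
    then have "b * \<gamma> \<ge> 0" using b by simp
    then show ?thesis using q by linarith
  next
    case False
    then have "a * \<gamma> \<le> b * \<gamma>" using b by (intro mult_right_mono_neg) (auto simp: a_def)
    then show ?thesis using a\<gamma> by linarith
  qed
  \<comment> \<open>At the origin the argument of ln is 0 and the value of g is a mere default; the
    bounds below therefore exclude y = 0, a null set.\<close>
  define g where "g y = exp (- lam * \<phi> y) *\<^sub>R mexp (ln (\<phi> y)) D" for y
  have [measurable]: "\<phi> \<in> borel_measurable borel" by (rule borel_measurable_continuous_onI[OF phi_cont])
  have "(\<lambda>t. mexp t D) \<in> borel_measurable borel"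
    by (intro borel_measurable_continuous_onI continuous_intros)
  from measurable_compose[OF _ this] have [measurable]: "(\<lambda>y. mexp (ln (\<phi> y)) D) \<in> borel_measurable borel"
    by measurable
  have gm [measurable]: "g \<in> borel_measurable borel" unfolding g_def by measurable
  obtain C1 where "C1 > 0" and C1: "\<And>t. t \<le> 0 \<Longrightarrow> norm (mexp t D) \<le> C1 * exp (\<gamma> * t)"
    using mexp_decay[OF \<gamma>] by blast
  obtain C2 \<rho> where "C2 > 0" and C2: "\<And>t. t \<ge> 0 \<Longrightarrow> norm (mexp t D) \<le> C2 * exp (\<rho> * t)"
    using mexp_growth_all[of D] by blast
  define C where "C = C1 + C2"
  have "C \<ge> 0" using \<open>C1 > 0\<close> \<open>C2 > 0\<close> by (simp add: C_def)
  have small: "norm (g y) \<le> C * \<phi> y powr \<gamma>" if "y \<noteq> 0" "\<phi> y \<le> 1" for y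
  proof -
    have p: "\<phi> y > 0" using phi_pos that by blast
    have "norm (g y) \<le> 1 * norm (mexp (ln (\<phi> y)) D)"
      unfolding g_def norm_scaleR using p lam_pos by (intro mult_right_mono) auto
    also have "\<dots> \<le> C1 * \<phi> y powr \<gamma>"
      using C1[of "ln (\<phi> y)"] that p by (simp add: powr_def)
    also have "\<dots> \<le> C * \<phi> y powr \<gamma>" using \<open>C2 > 0\<close> by (intro mult_right_mono) (auto simp: C_def)
    finally show ?thesis .
  qed
  have large: "norm (g y) \<le> C * (exp (- lam * \<phi> y) * \<phi> y powr \<rho>)" if "y \<noteq> 0" "\<phi> y > 1" for y
  proof -
    have "norm (mexp (ln (\<phi> y)) D) \<le> C2 * \<phi> y powr \<rho>"
      using C2[of "ln (\<phi> y)"] that by (simp add: powr_def)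
    also have "\<dots> \<le> C * \<phi> y powr \<rho>" using \<open>C1 > 0\<close> by (intro mult_right_mono) (auto simp: C_def)
    finally have "exp (- lam * \<phi> y) * norm (mexp (ln (\<phi> y)) D) \<le> exp (- lam * \<phi> y) * (C * \<phi> y powr \<rho>)"
      by (rule mult_left_mono) simp
    then show ?thesis by (simp add: g_def mult_ac)
  qed
  have intg: "integrable lborel (\<lambda>y. norm (g y) powr s)" if "s > 0" "s * \<gamma> > - q" for s
    using that lam_pos phi_pos \<open>C \<ge> 0\<close>
    by (intro integrable_norm_powr_of_phi_bounds[OF E phi_cont hom _ _ small large]) (auto simp: q_def)
  have "integrable lborel (\<lambda>y. powr_sum a b (norm (g y)))"
    unfolding powr_sum_def using \<open>a > 0\<close> b a\<gamma> b\<gamma> by (intro Bochner_Integration.integrable_add intg)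
  then have int2: "integrable lborel (\<lambda>y. powr_sum a b (2 * norm (g y)))"
    by (intro integrable_powr_sum_scale) auto
  \<comment> \<open>The two terms are integrable separately, so no cancellation between the shifted
    kernels is used. Writing - y as 0 - y lets one translation lemma serve both.\<close>
  have int: "integrable lborel (\<lambda>y. powr_sum a b (norm (g (x - y) - g (0 - y))))"
  proof (rule Bochner_Integration.integrable_bound)
    show "integrable lborel (\<lambda>y. powr_sum a b (2 * norm (g (x - y))) + powr_sum a b (2 * norm (g (0 - y))))"
      by (intro Bochner_Integration.integrable_add integrable_lborel_diff[OF int2])
    have "powr_sum a b (norm (g (x - y) - g (0 - y)))
        \<le> powr_sum a b (2 * norm (g (x - y))) + powr_sum a b (2 * norm (g (0 - y)))" for y
    proof -
      have "powr_sum a b (norm (g (x - y) - g (0 - y))) \<le> powr_sum a b (norm (g (x - y)) + norm (g (0 - y)))"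
        using \<open>a > 0\<close> b by (intro powr_sum_mono norm_triangle_ineq4) auto
      also have "\<dots> \<le> powr_sum a b (2 * norm (g (x - y))) + powr_sum a b (2 * norm (g (0 - y)))"
        using \<open>a > 0\<close> b by (intro powr_sum_add_le) auto
      finally show ?thesis .
    qed
    then show "AE y in lborel. norm (powr_sum a b (norm (g (x - y) - g (0 - y))))
        \<le> norm (powr_sum a b (2 * norm (g (x - y))) + powr_sum a b (2 * norm (g (0 - y))))"
      by (intro AE_I2) simp
  qed measurable
  have "KS_integrable P Mr (\<lambda>y. g (x - y) - g (0 - y))"
    by (rule KS_integrable_of_powr_bound[OF M_rm K[folded a_def] \<open>K \<ge> 0\<close> \<open>a > 0\<close> b(1) _ int]) measurable
  then show ?thesis
    by (simp add: g_def matrix_cpow_eq_mexp D_def)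
qed

end
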